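(* Let $k\geq 3$ be a square-free integer. Then \[ \left\{A\in \mathbb{A}\cap [e^{-e},e^{1/e}] : h(A) \text{ is algebraic and } \mathrm{ord}(A)=k\right\}=\left\{\left(\frac{k}{s}\right)^{\frac{s}{k}}: s\in\mathbb{N},\ k/e\leq s\leq ke,\ \gcd(s,k)=1\right\}. \]
   Context: $\mathbb{A}$ denotes the set of algebraic numbers. For a real $x\in[e^{-e},e^{1/e}]$, the sequence $x,\ x^x,\ x^{x^x},\ldots$ converges; its limit is denoted $h(x)$. It satisfies $h(x)=x^{h(x)}$ and $1/e\leq h(x)\leq e$. For an algebraic number $A$, $\mathrm{ord}(A):=\min\{n\in\mathbb{N}: A^n\in\mathbb{Q}\}$ if such $n$ exists, and $\mathrm{ord}(A)=\infty$ otherwise. *)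

theory Defs
  imports "HOL-Analysis.Analysis" "HOL-Computational_Algebra.Polynomial"
    "HOL-Computational_Algebra.Squarefree" "HOL-Library.Extended_Nat"
begin

fun tower :: "real \<Rightarrow> nat \<Rightarrow> real" where
  "tower x 0 = x"
| "tower x (Suc n) = x powr (tower x n)"

definition h :: "real \<Rightarrow> real" where
  "h x = lim (tower x)"

definition alg_ord :: "real \<Rightarrow> enat" where
  "alg_ord A = (if \<exists>n::nat. n \<ge> 1 \<and> A ^ n \<in> \<rat>
                then enat (LEAST n::nat. n \<ge> 1 \<and> A ^ n \<in> \<rat>) else \<infinity>)"

end

theory Submission
  imports Defs
begin

text \<open>
  If \<open>A = r\<^sup>1\<^sup>/\<^sup>k\<close> with \<open>r\<close> rational and \<open>y = h A\<close>, then \<open>A\<^sup>y = y\<close>, and an algebraic \<open>y\<close> must be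
  rational. This instance of Gelfond--Schneider needs only real analysis: \<open>A\<^sup>x\<close> lies in \<open>\<rat>(y)\<close> at all
  points \<open>x = k m + n y\<close>. The pigeonhole principle applied to Taylor coefficients yields small
  integers \<open>c\<^sub>i\<^sub>j\<close>, not all zero, such that \<open>F(x) = \<Sum> c\<^sub>i\<^sub>j x\<^sup>i A\<^sup>j\<^sup>x\<close> is tiny on a long interval. By
  Liouville's inequality \<open>F\<close> vanishes at those points in the interval, which is more real zeros than
  Rolle's theorem allows. So \<open>y = u/v\<close> in lowest terms, \<open>A = (u/v)\<^sup>v\<^sup>/\<^sup>u\<close>, and comparing prime exponents
  gives \<open>u = k\<close> when the order \<open>k \<ge> 3\<close> is squarefree. Conversely, \<open>y \<mapsto> y\<^sup>1\<^sup>/\<^sup>y\<close> maps \<open>[1/e, e]\<close> onto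
  \<open>[e\<^sup>-\<^sup>e, e\<^sup>1\<^sup>/\<^sup>e]\<close> with inverse \<open>h\<close>: the delicate point is that the double iterate of
  \<open>t \<mapsto> A\<^sup>t\<close> has slope at most 1 down to \<open>A = e\<^sup>-\<^sup>e\<close>, with equality at most once.
\<close>

section \<open>Lengths of integer polynomials and the Liouville inequality\<close>

abbreviation ipoly :: "int poly \<Rightarrow> real \<Rightarrow> real" where
  "ipoly p x \<equiv> poly (map_poly of_int p) x"

lemma ipoly_pCons: "ipoly (pCons a p) x = of_int a + x * ipoly p x"
  by (simp add: map_poly_pCons)

lemma ipoly_add: "ipoly (p + q) x = ipoly p x + ipoly q x"
  by (induction p q rule: poly_induct2) (simp_all add: map_poly_pCons algebra_simps)

lemma ipoly_smult: "ipoly (smult c p) x = of_int c * ipoly p x"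
  by (induction p) (simp_all add: map_poly_pCons algebra_simps)

lemma ipoly_mult: "ipoly (p * q) x = ipoly p x * ipoly q x"
  by (induction p) (simp_all add: map_poly_pCons ipoly_add ipoly_smult algebra_simps)

lemma ipoly_power: "ipoly (p ^ n) x = ipoly p x ^ n"
  by (induction n) (simp_all add: ipoly_mult)

lemma ipoly_monom: "ipoly (monom c n) x = of_int c * x ^ n"
  by (simp add: map_poly_monom poly_monom)

lemma ipoly_sum: "ipoly (\<Sum>i\<in>A. p i) x = (\<Sum>i\<in>A. ipoly (p i) x)"
  by (induction A rule: infinite_finite_induct) (simp_all add: ipoly_add)

text \<open>The l1 norm of the coefficients. It is subadditive and submultiplicative with no factor
  depending on the degree, so bounds for sums, products and powers stay clean.\<close>

definition plen :: "int poly \<Rightarrow> int" where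
  "plen p = (\<Sum>i\<le>degree p. \<bar>coeff p i\<bar>)"

lemma plen_0 [simp]: "plen 0 = 0"
  by (simp add: plen_def)

lemma plen_pCons: "plen (pCons a p) = \<bar>a\<bar> + plen p"
proof (cases "p = 0")
  case False
  then show ?thesis
    by (simp add: plen_def sum.atMost_Suc_shift del: sum.atMost_Suc)
qed (simp add: plen_def)

lemma plen_nonneg: "plen p \<ge> 0"
  by (simp add: plen_def sum_nonneg)

lemma plen_add: "plen (p + q) \<le> plen p + plen q"
  by (induction p q rule: poly_induct2) (auto simp: plen_pCons)

lemma plen_smult: "plen (smult c p) = \<bar>c\<bar> * plen p"
  by (induction p) (simp_all add: plen_pCons abs_mult algebra_simps)

lemma plen_diff: "plen (p - q) \<le> plen p + plen q"
  using plen_add[of p "smult (-1) q"] plen_smult[of "-1" q] by simp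

lemma plen_mult: "plen (p * q) \<le> plen p * plen q"
proof (induction p)
  case (pCons a p)
  have "plen (pCons a p * q) \<le> plen (smult a q) + plen (pCons 0 (p * q))"
    using plen_add by simp
  also have "\<dots> \<le> \<bar>a\<bar> * plen q + plen p * plen q"
    using pCons by (simp add: plen_smult plen_pCons)
  finally show ?case by (simp add: plen_pCons algebra_simps)
qed simp

lemma plen_power: "plen (p ^ n) \<le> plen p ^ n"
proof (induction n)
  case (Suc n)
  then show ?case
    using plen_mult[of p "p ^ n"] mult_left_mono[OF Suc plen_nonneg[of p]] by simp
qed (simp add: plen_def)

lemma plen_monom: "plen (monom c n) = \<bar>c\<bar>"
  by (induction n) (simp_all add: monom_0 monom_Suc plen_pCons)

lemma plen_sum: "plen (\<Sum>i\<in>A. p i) \<le> (\<Sum>i\<in>A. plen (p i))"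
proof (induction A rule: infinite_finite_induct)
  case (insert x F)
  then show ?case using plen_add[of "p x" "sum p F"] by simp
qed simp_all

lemma coeff_le_plen: "\<bar>coeff p i\<bar> \<le> plen p"
proof (cases "i \<le> degree p")
  case True
  then show ?thesis unfolding plen_def by (intro member_le_sum) auto
next
  case False
  then show ?thesis by (simp add: coeff_eq_0 plen_nonneg)
qed

lemma plen_pos: "p \<noteq> 0 \<Longrightarrow> plen p \<ge> 1"
  using coeff_le_plen[of p "degree p"] leading_coeff_neq_0[of p] by linarith

section \<open>Pseudo-division with control of sizes\<close>

text \<open>Each of the \<open>n\<close> rounds multiplies by the leading coefficient of
  \<open>R\<close> and cancels one top coefficient, so the length grows by a factor of at most
  \<open>2 * plen R\<close> per round. The value of the quotient at \<open>x\<close> is bounded too,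
  because Euclid's algorithm later compares the values of divisor and remainder at
  \<open>x\<close>.\<close>

lemma pseudo_division_bounds:
  fixes R F :: "int poly" and x H :: real
  assumes R: "degree R \<ge> 1" and H: "H \<ge> 1" "\<bar>x\<bar> \<le> H"
  shows "degree F < n + degree R \<Longrightarrow> \<exists>G Q. smult (lead_coeff R ^ n) F = Q * R + G
      \<and> degree G < degree R \<and> plen G \<le> (2 * plen R) ^ n * plen F
      \<and> \<bar>ipoly Q x\<bar> \<le> real n * (2 * real_of_int (plen R)) ^ n * plen F * H ^ n"
proof (induction n arbitrary: F)
  case 0
  then show ?case by (intro exI[of _ F] exI[of _ 0]) auto
next
  case (Suc n)
  define e where "e = degree R"
  define r where "r = lead_coeff R"
  define c where "c = coeff F (n + e)"
  \<comment> \<open>If \<open>c\<close> is zero the round is performed all the same; this keeps the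
    power of the leading coefficient equal to the number of rounds.\<close>
  define F' where "F' = smult r F - monom c n * R"
  define l where "l = plen R"
  have R0: "R \<noteq> 0" using R by auto
  have l1: "l \<ge> 1" using plen_pos[OF R0] by (simp add: l_def)
  have r: "\<bar>r\<bar> \<le> l" unfolding r_def l_def by (rule coeff_le_plen)
  have c: "\<bar>c\<bar> \<le> plen F" unfolding c_def by (rule coeff_le_plen)
  have "degree F' < n + e"
  proof (rule ccontr)
    assume "\<not> ?thesis"
    then have ge: "degree F' \<ge> n + e" by simp
    have "coeff F' i = 0" if "i \<ge> n + e" for i
    proof (cases "i = n + e")
      case True
      then show ?thesis
        by (simp add: F'_def coeff_monom_mult c_def r_def e_def)
    next
      case False
      with that have "i > n + e" by simp
      then show ?thesis using Suc.prems
        by (simp add: F'_def coeff_monom_mult e_def coeff_eq_0)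
    qed
    from this[OF ge] have "F' = 0" by simp
    with ge R show False by (simp add: e_def)
  qed
  from Suc.IH[OF this[unfolded e_def]] obtain G Q where GQ:
    "smult (r ^ n) F' = Q * R + G" "degree G < degree R"
    "plen G \<le> (2 * l) ^ n * plen F'"
    "\<bar>ipoly Q x\<bar> \<le> real n * (2 * real_of_int l) ^ n * plen F' * H ^ n"
    unfolding r_def l_def by auto
  have F': "plen F' \<le> 2 * l * plen F"
  proof -
    have "plen F' \<le> \<bar>r\<bar> * plen F + plen (monom c n * R)"
      unfolding F'_def using plen_diff plen_smult by metis
    also have "\<dots> \<le> \<bar>r\<bar> * plen F + \<bar>c\<bar> * l"
      using plen_mult[of "monom c n" R] by (simp add: plen_monom l_def)
    also have "\<dots> \<le> l * plen F + plen F * l"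
      using r c l1 by (intro add_mono mult_mono) (auto simp: plen_nonneg)
    finally show ?thesis by simp
  qed
  \<comment> \<open>The multiple of \<open>R\<close> subtracted in this round is scaled by
    \<open>r ^ n\<close> during the remaining \<open>n\<close> rounds.\<close>
  define Q' where "Q' = Q + monom (r ^ n * c) n"
  have "smult (r ^ Suc n) F = Q' * R + G"
  proof -
    have "smult (r ^ n) F' = smult (r ^ Suc n) F - monom (r ^ n * c) n * R"
      by (simp add: F'_def smult_diff_right smult_monom[symmetric] mult.commute[of r] del: smult_monom)
    with GQ(1) show ?thesis by (simp add: Q'_def algebra_simps)
  qed
  moreover have "plen G \<le> (2 * l) ^ Suc n * plen F"
  proof -
    have "(2 * l) ^ n * plen F' \<le> (2 * l) ^ n * (2 * l * plen F)"
      using F' l1 by (intro mult_left_mono) auto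
    with GQ(3) show ?thesis by (simp add: mult_ac)
  qed
  moreover have "\<bar>ipoly Q' x\<bar> \<le> Suc n * (2 * real_of_int l) ^ Suc n * plen F * H ^ Suc n"
  proof -
    have lr: "1 \<le> real_of_int l" using l1 by simp
    have pF: "0 \<le> real_of_int (plen F)" by (simp add: plen_nonneg)
    have "\<bar>ipoly Q' x\<bar> \<le> \<bar>ipoly Q x\<bar> + \<bar>of_int (r ^ n * c) * x ^ n\<bar>"
      unfolding Q'_def by (simp only: ipoly_add ipoly_monom abs_triangle_ineq)
    also have "\<dots> \<le> n * (2 * real_of_int l) ^ n * (2 * l * plen F) * H ^ n + (2 * real_of_int l) ^ Suc n * plen F * H ^ n"
    proof (rule add_mono)
      have "real_of_int (plen F') \<le> of_int (2 * l * plen F)"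
        using F' by (simp only: of_int_le_iff)
      then have "real n * (2 * real_of_int l) ^ n * real_of_int (plen F') * H ^ n
          \<le> real n * (2 * real_of_int l) ^ n * (2 * real_of_int l * real_of_int (plen F)) * H ^ n"
        using lr H by (intro mult_right_mono mult_left_mono) auto
      with GQ(4) show "\<bar>ipoly Q x\<bar> \<le> real n * (2 * real_of_int l) ^ n * (2 * l * plen F) * H ^ n" by simp
      have "\<bar>of_int (r ^ n * c) * x ^ n\<bar> = \<bar>real_of_int r\<bar> ^ n * \<bar>real_of_int c\<bar> * \<bar>x\<bar> ^ n"
        by (simp add: abs_mult power_abs)
      also have "\<dots> \<le> (2 * real_of_int l) ^ Suc n * plen F * H ^ n"
      proof (intro mult_mono power_mono)
        have "\<bar>real_of_int r\<bar> \<le> l" using r by linarith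
        then have "\<bar>real_of_int r\<bar> ^ n \<le> (2 * real_of_int l) ^ n" using lr by (intro power_mono) auto
        also have "\<dots> \<le> (2 * real_of_int l) ^ Suc n" using lr by (intro power_increasing) auto
        finally show "\<bar>real_of_int r\<bar> ^ n \<le> (2 * real_of_int l) ^ Suc n" .
      qed (use c lr H pF in auto)
      finally show "\<bar>of_int (r ^ n * c) * x ^ n\<bar> \<le> (2 * real_of_int l) ^ Suc n * plen F * H ^ n" .
    qed
    also have "\<dots> = (real (Suc n) * (2 * real_of_int l) ^ Suc n * plen F) * H ^ n"
      by (simp add: algebra_simps)
    also have "\<dots> \<le> (real (Suc n) * (2 * real_of_int l) ^ Suc n * plen F) * H ^ Suc n"
      using lr H pF by (intro mult_left_mono power_increasing) auto
    finally show ?thesis by simp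
  qed
  ultimately show ?case using GQ(2) unfolding r_def l_def by blast
qed

section \<open>Minimal annihilators and Liouville's inequality\<close>

text \<open>Minimality of the degree stands in for irreducibility: a nonzero integer polynomial of
  smaller degree cannot vanish at \<open>x\<close>.\<close>

lemma minimal_annihilator:
  assumes "algebraic (x :: real)"
  obtains f where "f \<noteq> 0" "ipoly f x = 0" "degree f \<ge> 1"
    "\<And>p. p \<noteq> 0 \<Longrightarrow> ipoly p x = 0 \<Longrightarrow> degree f \<le> degree p"
proof -
  obtain p0 :: "int poly" where p0: "p0 \<noteq> 0" "ipoly p0 x = 0"
    using algebraicE'[OF assms] by blast
  define f where "f = arg_min degree (\<lambda>p. p \<noteq> 0 \<and> ipoly p x = 0)"
  have f: "f \<noteq> 0 \<and> ipoly f x = 0"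
    unfolding f_def by (rule arg_min_natI) (use p0 in auto)
  have le: "degree f \<le> degree p" if "p \<noteq> 0" "ipoly p x = 0" for p
    unfolding f_def by (rule arg_min_nat_le) (use that in auto)
  have "degree f \<ge> 1"
  proof (rule ccontr)
    assume "\<not> ?thesis"
    then obtain a where "f = [:a:]" by (metis degree_eq_zeroE less_one not_le)
    with f show False by (simp add: map_poly_pCons)
  qed
  with f le that show ?thesis by blast
qed

text \<open>Euclid's algorithm started at the minimal annihilator: its remainders have bounded degree and
  cannot vanish at \<open>x\<close>, so the number of steps and all losses depend on \<open>x\<close> alone.\<close>

lemma Liouville_low_degree:
  fixes x :: real
  assumes f: "f \<noteq> 0" "ipoly f x = 0"
    and min: "\<And>p. p \<noteq> 0 \<Longrightarrow> ipoly p x = 0 \<Longrightarrow> degree f \<le> degree p"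
  shows "e < degree f \<Longrightarrow> \<exists>c::nat. c \<ge> 1 \<and> (\<forall>R. R \<noteq> 0 \<longrightarrow> degree R \<le> e \<longrightarrow>
           1 \<le> \<bar>ipoly R x\<bar> * c * real_of_int (plen R) ^ c)"
proof (induction e)
  case 0
  have "1 \<le> \<bar>ipoly R x\<bar> * plen R" if R: "R \<noteq> 0" "degree R \<le> 0" for R
  proof -
    from R(2) obtain a where a: "R = [:a:]" by (auto elim: degree_eq_zeroE)
    with R(1) have "\<bar>a\<bar> \<ge> 1" by auto
    then have "real_of_int 1 \<le> of_int (\<bar>a\<bar> * \<bar>a\<bar>)"
      using mult_mono[of 1 "\<bar>a\<bar>" 1 "\<bar>a\<bar>"] by (subst of_int_le_iff) simp
    with a show ?thesis by (simp add: map_poly_pCons plen_pCons)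
  qed
  then show ?case by (intro exI[of _ 1]) auto
next
  case (Suc e)
  then obtain c where c: "c \<ge> 1" and
    IH: "\<And>R. R \<noteq> 0 \<Longrightarrow> degree R \<le> e \<Longrightarrow> 1 \<le> \<bar>ipoly R x\<bar> * real c * real_of_int (plen R) ^ c"
    by auto
  define n where "n = degree f"
  have n1: "n \<ge> 1" using Suc.prems by (simp add: n_def)
  define H where "H = max 1 \<bar>x\<bar>"
  have H: "H \<ge> 1" "\<bar>x\<bar> \<le> H" by (auto simp: H_def)
  define K where "K = real n * 2 ^ n * plen f * H ^ n * c * (2 ^ n * plen f) ^ c"
  \<comment> \<open>The maximum meets three demands: the bound for degree at most \<open>e\<close>,
    the constant factor \<open>K\<close>, and the exponent of \<open>plen R\<close> that one
    division produces.\<close>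
  define c' where "c' = max c (max (nat \<lceil>K\<rceil>) (n + n * c))"
  have Kc: "K \<le> c'" unfolding c'_def by linarith
  have "1 \<le> \<bar>ipoly R x\<bar> * c' * real_of_int (plen R) ^ c'" if R: "R \<noteq> 0" "degree R \<le> Suc e" for R
  proof -
    define l where "l = plen R"
    have l1: "1 \<le> l" using plen_pos[OF R(1)] by (simp add: l_def)
    have lr: "1 \<le> real_of_int l" using l1 by simp
    show ?thesis
    proof (cases "degree R \<le> e")
      case True
      have "1 \<le> \<bar>ipoly R x\<bar> * real c * real_of_int l ^ c"
        using IH[OF R(1) True] by (simp add: l_def)
      also have "\<dots> \<le> \<bar>ipoly R x\<bar> * real c' * real_of_int l ^ c'"
        using lr by (intro mult_mono power_increasing) (auto simp: c'_def)
      finally show ?thesis by (simp add: l_def)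
    next
      case False
      then have dR: "degree R = Suc e" using R by simp
      then have R1: "degree R \<ge> 1" by simp
      obtain G Q where GQ: "smult (lead_coeff R ^ n) f = Q * R + G" "degree G < degree R"
        "plen G \<le> (2 * l) ^ n * plen f"
        "\<bar>ipoly Q x\<bar> \<le> real n * (2 * real_of_int l) ^ n * plen f * H ^ n"
        using pseudo_division_bounds[OF R1 H, of f n] R1 unfolding n_def l_def by auto
      have Rx: "ipoly R x \<noteq> 0" using min[OF R(1)] dR Suc.prems by auto
      have eq: "ipoly Q x * ipoly R x + ipoly G x = 0"
        using arg_cong[OF GQ(1), of "\<lambda>p. ipoly p x"] f by (simp add: ipoly_smult ipoly_add ipoly_mult)
      have lc: "lead_coeff R ^ n \<noteq> 0" using R(1) by simp
      \<comment> \<open>If the division were exact, \<open>Q\<close> would vanish at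
        \<open>x\<close> because \<open>R\<close> does not, yet \<open>Q\<close> has smaller degree
        than \<open>f\<close>.\<close>
      have G0: "G \<noteq> 0"
      proof
        assume G: "G = 0"
        have Q0: "Q \<noteq> 0" using GQ(1) G f(1) lc by (auto simp: smult_eq_0_iff)
        have "ipoly Q x = 0" using eq G Rx by simp
        from min[OF Q0 this] have "degree f \<le> degree Q" .
        moreover have "degree f = degree Q + degree R"
          using arg_cong[OF GQ(1), of degree] G lc Q0 R(1) by (simp add: degree_mult_eq)
        ultimately show False using R1 by simp
      qed
      have pf: "1 \<le> real_of_int (plen f)" using plen_pos[OF f(1)] by simp
      have Gr: "real_of_int (plen G) \<le> (2 * real_of_int l) ^ n * plen f"
      proof -
        have "real_of_int (plen G) \<le> of_int ((2 * l) ^ n * plen f)"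
          using GQ(3) by (simp only: of_int_le_iff)
        then show ?thesis by (simp only: of_int_mult of_int_power of_int_numeral)
      qed
      have "0 \<le> K" using pf H by (simp add: K_def)
      have "1 \<le> \<bar>ipoly G x\<bar> * c * real_of_int (plen G) ^ c"
        using IH[OF G0] GQ(2) dR by simp
      \<comment> \<open>As \<open>f\<close> vanishes at \<open>x\<close>, the remainder there is
        minus the product of \<open>Q\<close> and \<open>R\<close>: a lower bound for the remainder
        and an upper bound for \<open>Q\<close> bound \<open>R\<close> from below.\<close>
      also have "\<bar>ipoly G x\<bar> = \<bar>ipoly R x\<bar> * \<bar>ipoly Q x\<bar>"
        using eq by (metis abs_minus_cancel abs_mult add_eq_0_iff mult.commute)
      also have "\<bar>ipoly R x\<bar> * \<bar>ipoly Q x\<bar> * c * real_of_int (plen G) ^ c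
          \<le> \<bar>ipoly R x\<bar> * (n * (2 * real_of_int l) ^ n * plen f * H ^ n) * c * ((2 * real_of_int l) ^ n * plen f) ^ c"
        using GQ(4) Gr lr pf H
        by (intro mult_mono power_mono) (auto simp: plen_nonneg)
      also have "\<dots> = \<bar>ipoly R x\<bar> * K * real_of_int l ^ (n + n * c)"
        by (simp add: K_def power_mult_distrib power_add mult_ac flip: power_mult)
      also have "\<dots> \<le> \<bar>ipoly R x\<bar> * c' * real_of_int l ^ c'"
        using lr Kc \<open>0 \<le> K\<close> by (intro mult_mono power_increasing) (auto simp: c'_def)
      finally show ?thesis by (simp add: l_def)
    qed
  qed
  moreover have "c' \<ge> 1" using c by (simp add: c'_def)
  ultimately show ?case by blast
qed

text \<open>Pseudo-division of \<open>P\<close> by the minimal annihilator leaves a remainder of low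
  degree whose value at \<open>x\<close> is that of \<open>P\<close> times a power of the leading
  coefficient, so the low-degree bound applies to it. The loss is exponential in \<open>n\<close>
  and polynomial in \<open>plen P\<close>.\<close>

lemma Liouville_inequality:
  assumes "algebraic (x :: real)"
  obtains C :: nat where "C \<ge> 1"
    "\<And>P n. degree P \<le> n \<Longrightarrow> ipoly P x \<noteq> 0 \<Longrightarrow> 1 \<le> \<bar>ipoly P x\<bar> * (real C ^ Suc n * plen P) ^ C"
proof -
  obtain f where f: "f \<noteq> 0" "ipoly f x = 0" "degree f \<ge> 1"
    and min: "\<And>p. p \<noteq> 0 \<Longrightarrow> ipoly p x = 0 \<Longrightarrow> degree f \<le> degree p"
    using minimal_annihilator[OF assms] by blast
  obtain c :: nat where c: "c \<ge> 1"
    and low: "\<And>R. R \<noteq> 0 \<Longrightarrow> degree R < degree f \<Longrightarrow> 1 \<le> \<bar>ipoly R x\<bar> * c * real_of_int (plen R) ^ c"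
    using Liouville_low_degree[OF f(1,2) min, of "degree f - 1"] f(3)
    by (metis Suc_diff_1 Suc_le_lessD diff_less less_Suc_eq_le zero_less_one One_nat_def)
  define H where "H = max 1 \<bar>x\<bar>"
  have H: "H \<ge> 1" "\<bar>x\<bar> \<le> H" by (auto simp: H_def)
  define a where "a = nat \<bar>lead_coeff f\<bar>"
  define l where "l = nat (plen f)"
  have l1: "l \<ge> 1" using plen_pos[OF f(1)] by (simp add: l_def)
  have a1: "a \<ge> 1" using f(1) by (simp add: a_def Suc_le_eq)
  \<comment> \<open>The product dominates all constants that occur, so one \<open>C\<close> can
    serve as base and as exponent.\<close>
  define C where "C = c * a * (2 * l)"
  have Cc: "C \<ge> c" "C \<ge> 1" using a1 l1 c by (auto simp: C_def)
  have "1 \<le> \<bar>ipoly P x\<bar> * (real C ^ Suc n * plen P) ^ C" if P: "degree P \<le> n" "ipoly P x \<noteq> 0" for P n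
  proof -
    have "degree P < Suc n + degree f" using P by simp
    from pseudo_division_bounds[OF f(3) H this] obtain G Q where GQ:
      "smult (lead_coeff f ^ Suc n) P = Q * f + G" "degree G < degree f"
      "plen G \<le> (2 * plen f) ^ Suc n * plen P" by blast
    have eq: "ipoly G x = of_int (lead_coeff f) ^ Suc n * ipoly P x"
      using arg_cong[OF GQ(1), of "\<lambda>p. ipoly p x"] f(2) by (simp add: ipoly_smult ipoly_add ipoly_mult)
    have "ipoly G x \<noteq> 0" using eq P f(1) by simp
    then have G0: "G \<noteq> 0" by auto
    have pP: "1 \<le> real_of_int (plen P)" using plen_pos[of P] P by fastforce
    have lf: "real_of_int (plen f) = real l" by (simp add: l_def plen_nonneg)
    have lr: "real l \<ge> 1" using l1 by simp
    have ar: "real a \<ge> 1" using a1 by simp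
    have cr: "real c \<ge> 1" using c by simp
    have Gr: "real_of_int (plen G) \<le> (2 * real l) ^ Suc n * plen P"
    proof -
      have "real_of_int (plen G) \<le> of_int ((2 * plen f) ^ Suc n * plen P)"
        using GQ(3) by (simp only: of_int_le_iff)
      then show ?thesis by (simp only: of_int_mult of_int_power lf of_int_numeral of_nat_mult of_nat_power of_nat_numeral of_int_of_nat_eq)
    qed
    have "1 \<le> \<bar>ipoly G x\<bar> * c * real_of_int (plen G) ^ c" using low[OF G0 GQ(2)] .
    also have "\<bar>ipoly G x\<bar> = real a ^ Suc n * \<bar>ipoly P x\<bar>"
      unfolding eq abs_mult power_abs a_def by simp
    also have "real a ^ Suc n * \<bar>ipoly P x\<bar> * c * real_of_int (plen G) ^ c
        \<le> real a ^ Suc n * \<bar>ipoly P x\<bar> * c * ((2 * real l) ^ Suc n * plen P) ^ c"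
      using Gr by (intro mult_left_mono power_mono) (auto simp: plen_nonneg)
    also have "\<dots> = \<bar>ipoly P x\<bar> * (real a ^ Suc n * c * ((2 * real l) ^ Suc n * plen P) ^ c)"
      by (simp add: mult_ac)
    \<comment> \<open>The factors \<open>a\<close> and \<open>c\<close> are padded to the exponents
      of the last factor, so that all three merge into \<open>C\<close>.\<close>
    also have "\<dots> \<le> \<bar>ipoly P x\<bar> * ((real a ^ Suc n) ^ c * (c ^ Suc n) ^ c * ((2 * real l) ^ Suc n * plen P) ^ c)"
    proof (intro mult_left_mono mult_right_mono mult_mono)
      show "real a ^ Suc n \<le> (real a ^ Suc n) ^ c"
        using ar c by (intro self_le_power one_le_power) auto
      have "real c \<le> real c ^ Suc n" using cr by (intro self_le_power) auto
      also have "\<dots> \<le> (real c ^ Suc n) ^ c" using cr c by (intro self_le_power one_le_power) auto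
      finally show "real c \<le> (c ^ Suc n) ^ c" by simp
    qed (use pP in auto)
    also have "\<dots> = \<bar>ipoly P x\<bar> * (real C ^ Suc n * plen P) ^ c"
      by (simp add: C_def power_mult_distrib mult_ac)
    also have "\<dots> \<le> \<bar>ipoly P x\<bar> * (real C ^ Suc n * plen P) ^ C"
    proof (intro mult_left_mono power_increasing)
      have "1 \<le> real C ^ Suc n" using Cc(2) by (intro one_le_power) simp
      then show "1 \<le> real C ^ Suc n * plen P" using pP by (metis mult_mono mult_1 zero_le_one order_trans)
    qed (use Cc in auto)
    finally show ?thesis .
  qed
  with Cc(2) that show ?thesis by blast
qed

section \<open>Real zeros of exponential polynomials\<close>

text \<open>Induction removes the largest zero. The clause \<open>z < Max Z\<close> keeps the zeros
  found so far apart from the new one, which Rolle's theorem places between the two largest elements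
  of \<open>Z\<close>.\<close>

lemma Rolle_card_zeros:
  fixes f f' :: "real \<Rightarrow> real"
  assumes D: "\<And>x. (f has_real_derivative f' x) (at x)"
  shows "finite Z \<Longrightarrow> card Z = Suc n \<Longrightarrow> \<forall>z\<in>Z. f z = 0 \<Longrightarrow>
    \<exists>Z'. finite Z' \<and> card Z' = n \<and> (\<forall>z\<in>Z'. f' z = 0 \<and> z < Max Z)"
proof (induction n arbitrary: Z)
  case 0
  show ?case by (intro exI[of _ "{}"]) auto
next
  case (Suc n)
  define m where "m = Max Z"
  have mZ: "m \<in> Z" using Suc.prems by (auto simp: m_def intro!: Max_in)
  define Y where "Y = Z - {m}"
  have Y: "finite Y" "card Y = Suc n" "\<forall>z\<in>Y. f z = 0"
    using Suc.prems mZ by (auto simp: Y_def)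
  have Y0: "Y \<noteq> {}" using Y(2) by auto
  define y where "y = Max Y"
  have yY: "y \<in> Y" unfolding y_def using Y(1) Y0 by (rule Max_in)
  then have ym: "y < m"
    using Suc.prems(1) by (auto simp: Y_def m_def order_less_le)
  obtain W where W: "finite W" "card W = n" "\<forall>z\<in>W. f' z = 0 \<and> z < y"
    using Suc.IH[OF Y] y_def by blast
  have "\<exists>z>y. z < m \<and> (f has_real_derivative 0) (at z)"
  proof (rule Rolle[OF ym])
    show "f y = f m" using yY mZ Suc.prems Y by auto
    show "continuous_on {y..m} f"
      using D by (meson DERIV_isCont continuous_at_imp_continuous_on)
    show "\<And>x. y < x \<Longrightarrow> x < m \<Longrightarrow> f differentiable at x"
      using D real_differentiable_def by blast
  qed
  then obtain z where z: "y < z" "z < m" "(f has_real_derivative 0) (at z)" by blast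
  have "f' z = 0" using DERIV_unique[OF D z(3)] .
  have "z \<notin> W" using W z by auto
  then show ?case
    using W z \<open>f' z = 0\<close> unfolding m_def[symmetric]
    by (intro exI[of _ "insert z W"]) auto
qed

text \<open>\<open>twist a p\<close> is the polynomial with \<open>(p e\<^sup>a\<^sup>z)' = twist a p e\<^sup>a\<^sup>z\<close>.\<close>

definition twist :: "real \<Rightarrow> real poly \<Rightarrow> real poly" where
  "twist a p = pderiv p + smult a p"

lemma twist_coeff_vanish:
  "(\<And>i. i \<ge> d \<Longrightarrow> coeff p i = 0) \<Longrightarrow> i \<ge> d \<Longrightarrow> coeff ((twist a ^^ s) p) i = 0"
  by (induction s arbitrary: i) (auto simp: twist_def coeff_pderiv)

text \<open>For nonzero \<open>a\<close>, \<open>twist a q = 0\<close> makes \<open>q\<close> a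
  multiple of its derivative. By degrees \<open>q\<close> is constant, so its derivative vanishes
  and \<open>q\<close> with it.\<close>

lemma twist_pow_eq_0:
  assumes "a \<noteq> 0"
  shows "(twist a ^^ s) p = 0 \<Longrightarrow> p = 0"
proof (induction s)
  case (Suc s)
  define q where "q = (twist a ^^ s) p"
  have "twist a q = 0" using Suc.prems by (simp add: q_def)
  then have "pderiv q + smult a q = 0" by (simp only: twist_def)
  then have "smult (-a) q = pderiv q" by (simp add: eq_neg_iff_add_eq_0)
  then have "degree q = degree q - 1"
    using assms by (metis degree_pderiv degree_smult_eq neg_equal_0_iff_equal)
  then have "degree q = 0" by simp
  then have "pderiv q = 0" by (simp add: pderiv_eq_0_iff)
  with \<open>smult (-a) q = pderiv q\<close> assms have "q = 0" by (simp add: smult_eq_0_iff)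
  with Suc.IH show ?case by (simp add: q_def)
qed simp

text \<open>\<open>twist 0\<close> is plain differentiation.\<close>

lemma twist_0_pow_vanish:
  assumes "\<And>i. i \<ge> d \<Longrightarrow> coeff p i = 0"
  shows "(twist 0 ^^ d) p = 0"
proof -
  have "i + s \<ge> d \<Longrightarrow> coeff ((twist 0 ^^ s) p) i = 0" for i s
    by (induction s arbitrary: i) (auto simp: twist_def coeff_pderiv assms)
  then show ?thesis by (intro poly_eqI) simp
qed

text \<open>Induction on the number of frequencies: \<open>d\<close> derivatives kill the polynomial
  at frequency 0, cost \<open>d\<close> zeros by Rolle, and only twist the other polynomials.
  Dividing by \<open>exp (w * z)\<close> then lowers the remaining frequencies by one step.\<close>

lemma exp_poly_zeros:
  fixes w :: real and P :: "nat \<Rightarrow> real poly"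
  assumes w: "w \<noteq> 0"
  shows "(\<And>j i. j < J \<Longrightarrow> i \<ge> d \<Longrightarrow> coeff (P j) i = 0) \<Longrightarrow>
    finite Z \<Longrightarrow> card Z = J * d \<Longrightarrow>
    (\<And>z. z \<in> Z \<Longrightarrow> (\<Sum>j<J. poly (P j) z * exp (real j * w * z)) = 0) \<Longrightarrow> j < J \<Longrightarrow> P j = 0"
proof (induction J arbitrary: P Z j)
  case (Suc J)
  \<comment> \<open>\<open>F s\<close> is the \<open>s\<close>-th derivative of the exponential
    sum.\<close>
  define F where "F = (\<lambda>s z. \<Sum>j<Suc J. poly ((twist (real j * w) ^^ s) (P j)) z * exp (real j * w * z))"
  have D: "(F s has_real_derivative F (Suc s) z) (at z)" for s z
    unfolding F_def
    by (auto intro!: derivative_eq_intros sum.cong simp: twist_def algebra_simps)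
  have zeros: "\<exists>Y. finite Y \<and> card Y = Suc J * d - s \<and> (\<forall>z\<in>Y. F s z = 0)" if "s \<le> d" for s
    using that
  proof (induction s)
    case 0
    show ?case using Suc.prems(2-4) by (intro exI[of _ Z]) (auto simp: F_def)
  next
    case (Suc s)
    then obtain Y where Y: "finite Y" "card Y = Suc J * d - s" "\<forall>z\<in>Y. F s z = 0" by auto
    have "card Y = Suc (Suc J * d - Suc s)" using Y(2) Suc.prems by (simp add: algebra_simps)
    from Rolle_card_zeros[OF D Y(1) this Y(3)] show ?case by blast
  qed
  then obtain Y where Y: "finite Y" "card Y = J * d" "\<forall>z\<in>Y. F d z = 0" by force
  have "(twist (real (Suc i) * w) ^^ d) (P (Suc i)) = 0" if "i < J" for i
  proof (rule Suc.IH[OF _ Y(1,2) _ that])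
    show "coeff ((twist (real (Suc i') * w) ^^ d) (P (Suc i'))) l = 0" if "i' < J" "l \<ge> d" for i' l
      using that Suc.prems(1) by (intro twist_coeff_vanish) auto
    fix z assume "z \<in> Y"
    then have "F d z = 0" using Y by auto
    moreover have "F d z = (\<Sum>j<J. poly ((twist (real (Suc j) * w) ^^ d) (P (Suc j))) z * exp (real (Suc j) * w * z))"
    proof -
      have "(twist 0 ^^ d) (P 0) = 0" using Suc.prems(1) by (intro twist_0_pow_vanish) auto
      then show ?thesis unfolding F_def by (subst sum.lessThan_Suc_shift) simp
    qed
    moreover have "\<dots> = exp (w * z) * (\<Sum>j<J. poly ((twist (real (Suc j) * w) ^^ d) (P (Suc j))) z * exp (real j * w * z))"
      by (simp add: sum_distrib_left algebra_simps exp_add)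
    ultimately show "(\<Sum>j<J. poly ((twist (real (Suc j) * w) ^^ d) (P (Suc j))) z * exp (real j * w * z)) = 0"
      by simp
  qed
  then have PS: "P (Suc i) = 0" if "i < J" for i
    using twist_pow_eq_0 that w by (metis mult_eq_0_iff nat.distinct(1) of_nat_eq_0_iff)
  \<comment> \<open>With all other terms gone, \<open>P 0\<close> vanishes on \<open>Z\<close>,
    which has more elements than the degree of \<open>P 0\<close> allows.\<close>
  have "P 0 = 0"
  proof (rule ccontr)
    assume P0: "P 0 \<noteq> 0"
    have "Z \<subseteq> {z. poly (P 0) z = 0}"
      using Suc.prems(4) PS by (subst (asm) sum.lessThan_Suc_shift) auto
    then have "card Z \<le> card {z. poly (P 0) z = 0}"
      using P0 by (intro card_mono poly_roots_finite) auto
    also have "\<dots> \<le> degree (P 0)" using P0 by (rule card_poly_roots_bound)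
    also have "\<dots> < d"
      using P0 Suc.prems(1)[of 0] by (metis leading_coeff_neq_0 not_le zero_less_Suc)
    finally show False using Suc.prems(3) by simp
  qed
  with PS Suc.prems(5) show ?case by (cases j) auto
qed simp

section \<open>Auxiliary functions with small values\<close>

text \<open>Pigeonhole: values of combinations with coefficients in \<open>0..X\<close>, divided by
  \<open>eps\<close> and rounded down, fall into \<open>(2 * M + 1) ^ T\<close> classes, fewer than
  there are coefficient vectors. The difference of two vectors in one class is the desired
  \<open>c\<close>.\<close>

lemma small_integer_combination:
  fixes u :: "'i \<Rightarrow> nat \<Rightarrow> real"
  assumes I: "finite I" and u: "\<And>i t. i \<in> I \<Longrightarrow> t < T \<Longrightarrow> \<bar>u i t\<bar> \<le> B"
    and eps: "eps > 0" and M: "real (card I) * real X * B \<le> real M * eps"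
    and count: "(2 * M + 1) ^ T < (X + 1) ^ card I"
  obtains c :: "'i \<Rightarrow> int" where "\<And>i. i \<in> I \<Longrightarrow> \<bar>c i\<bar> \<le> int X" "\<exists>i\<in>I. c i \<noteq> 0"
    "\<And>t. t < T \<Longrightarrow> \<bar>\<Sum>i\<in>I. of_int (c i) * u i t\<bar> \<le> eps"
proof -
  define A where "A = (\<Pi>\<^sub>E i\<in>I. {0..int X})"
  define Y where "Y = (\<Pi>\<^sub>E t\<in>{..<T}. {- int M..int M})"
  define v where "v = (\<lambda>c t. (\<Sum>i\<in>I. of_int (c i) * u i t) / eps)"
  define f where "f = (\<lambda>c. restrict (\<lambda>t. \<lfloor>v c t\<rfloor>) {..<T})"
  have "f c \<in> Y" if c: "c \<in> A" for c
  proof -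
    have "\<bar>v c t\<bar> \<le> M" if t: "t < T" for t
    proof -
      have "\<bar>\<Sum>i\<in>I. of_int (c i) * u i t\<bar> \<le> (\<Sum>i\<in>I. \<bar>of_int (c i) * u i t\<bar>)" by (rule sum_abs)
      also have "\<dots> \<le> (\<Sum>i\<in>I. real X * B)"
      proof (rule sum_mono)
        fix i assume i: "i \<in> I"
        then have "c i \<in> {0..int X}" using c by (auto simp: A_def)
        then have "\<bar>real_of_int (c i)\<bar> \<le> real X" by auto
        then show "\<bar>of_int (c i) * u i t\<bar> \<le> real X * B"
          unfolding abs_mult using u[OF i t] by (intro mult_mono) auto
      qed
      also have "\<dots> \<le> M * eps" using M by simp
      finally show ?thesis using eps by (simp add: v_def abs_divide divide_le_eq)
    qed
    then have "- real M \<le> v c t \<and> v c t \<le> real M" if "t < T" for t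
      using that by (meson abs_le_D1 abs_le_iff minus_le_iff)
    then have "- int M \<le> \<lfloor>v c t\<rfloor> \<and> \<lfloor>v c t\<rfloor> \<le> int M" if "t < T" for t
      using that by (smt (verit) le_floor_iff floor_mono floor_of_nat of_int_minus of_int_of_nat_eq)
    then show ?thesis unfolding Y_def f_def by auto
  qed
  then have "f ` A \<subseteq> Y" by auto
  moreover have "finite Y" unfolding Y_def by (intro finite_PiE) auto
  ultimately have "card (f ` A) \<le> card Y" by (rule card_mono[rotated])
  also have "\<dots> = (2 * M + 1) ^ T"
    unfolding Y_def by (subst card_PiE) (auto simp: nat_add_distrib nat_mult_distrib)
  also have "\<dots> < card A"
    using count unfolding A_def by (subst card_PiE) (auto simp: I nat_add_distrib)
  finally have "\<not> inj_on f A" by (rule pigeonhole)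
  then obtain c1 c2 where cc: "c1 \<in> A" "c2 \<in> A" "c1 \<noteq> c2" "f c1 = f c2"
    by (auto simp: inj_on_def)
  define c where "c = (\<lambda>i. c1 i - c2 i)"
  show ?thesis
  proof (rule that[of c])
    show "\<bar>c i\<bar> \<le> int X" if "i \<in> I" for i
    proof -
      have "c1 i \<in> {0..int X}" "c2 i \<in> {0..int X}" using cc that by (auto simp: A_def)
      then show ?thesis by (auto simp: c_def)
    qed
    show "\<exists>i\<in>I. c i \<noteq> 0"
    proof (rule ccontr)
      assume "\<not> ?thesis"
      then have "c1 i = c2 i" if "i \<in> I" for i using that by (simp add: c_def)
      then have "c1 = c2" using cc(1,2) unfolding A_def by (intro PiE_ext) auto
      with cc(3) show False ..
    qed
    show "\<bar>\<Sum>i\<in>I. of_int (c i) * u i t\<bar> \<le> eps" if "t < T" for t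
    proof -
      have "\<lfloor>v c1 t\<rfloor> = \<lfloor>v c2 t\<rfloor>"
        using fun_cong[OF cc(4), of t] that by (simp add: f_def)
      then have "\<bar>v c1 t - v c2 t\<bar> \<le> 1" by linarith
      moreover have "v c1 t - v c2 t = (\<Sum>i\<in>I. of_int (c i) * u i t) / eps"
        by (simp add: v_def c_def diff_divide_distrib sum_subtractf left_diff_distrib)
      ultimately show ?thesis using eps by (simp add: abs_divide divide_le_eq)
    qed
  qed
qed

section \<open>Taylor expansion of exponential monomials\<close>

text \<open>The coefficient of \<open>x ^ t\<close> in the Taylor series of
  \<open>x ^ i * exp (y * x)\<close> at 0.\<close>

definition exp_mono_coeff :: "nat \<Rightarrow> real \<Rightarrow> nat \<Rightarrow> real" where
  "exp_mono_coeff i y t = (if t < i then 0 else y ^ (t - i) / fact (t - i))"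

lemma exp_mono_coeff_sums: "(\<lambda>t. exp_mono_coeff i y t * x ^ t) sums (x ^ i * exp (y * x))"
proof -
  have "(\<lambda>n. x ^ i * ((y * x) ^ n /\<^sub>R fact n)) sums (x ^ i * exp (y * x))"
    by (intro sums_mult exp_converges)
  then have "(\<lambda>n. exp_mono_coeff i y (n + i) * x ^ (n + i)) sums (x ^ i * exp (y * x))"
    by (simp add: exp_mono_coeff_def field_simps power_add)
  then show ?thesis
    by (subst (asm) sums_zero_iff_shift) (auto simp: exp_mono_coeff_def)
qed

text \<open>A single term of the series of \<open>exp (2 * \<bar>y\<bar> * R)\<close> is at most its
  sum; doubling the radius yields the decay \<open>1 / 2 ^ t\<close>.\<close>

lemma exp_mono_coeff_bound:
  assumes R: "R \<ge> 1"
  shows "\<bar>exp_mono_coeff i y t\<bar> * R ^ t \<le> (2 * R) ^ i * exp (2 * \<bar>y\<bar> * R) / 2 ^ t"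
proof (cases "t < i")
  case False
  define n where "n = t - i"
  have t: "t = n + i" using False by (simp add: n_def)
  have "(2 * \<bar>y\<bar> * R) ^ n / fact n \<le> exp (2 * \<bar>y\<bar> * R)"
  proof -
    let ?z = "2 * \<bar>y\<bar> * R"
    have "(\<Sum>m\<in>{n}. ?z ^ m /\<^sub>R fact m) \<le> (\<Sum>m. ?z ^ m /\<^sub>R fact m)"
      using R by (intro sum_le_suminf sums_summable[OF exp_converges]) auto
    also have "\<dots> = exp ?z" using sums_unique[OF exp_converges] by metis
    finally show ?thesis by (simp add: field_simps)
  qed
  then have "R ^ i * ((2 * \<bar>y\<bar> * R) ^ n / fact n) \<le> R ^ i * exp (2 * \<bar>y\<bar> * R)"
    using R by (intro mult_left_mono) auto
  then show ?thesis
    by (simp add: t exp_mono_coeff_def abs_divide power_abs abs_mult field_simps power_add power_mult_distrib)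
qed (use R in \<open>simp add: exp_mono_coeff_def\<close>)

text \<open>The coefficient bound turns the tail into a geometric series of ratio 1/2, whose sum is
  the factor 2.\<close>

lemma exp_mono_Taylor:
  assumes R: "R \<ge> 1" and x: "\<bar>x\<bar> \<le> R"
  shows "\<bar>x ^ i * exp (y * x) - (\<Sum>t<T. exp_mono_coeff i y t * x ^ t)\<bar>
    \<le> 2 * ((2 * R) ^ i * exp (2 * \<bar>y\<bar> * R)) / 2 ^ T"
proof -
  define B where "B = (2 * R) ^ i * exp (2 * \<bar>y\<bar> * R)"
  have s: "(\<lambda>n. exp_mono_coeff i y (n + T) * x ^ (n + T)) sums
      (x ^ i * exp (y * x) - (\<Sum>t<T. exp_mono_coeff i y t * x ^ t))"
    by (intro sums_split_initial_segment exp_mono_coeff_sums)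
  have "(\<lambda>n. B / 2 ^ T * (1 / 2) ^ n) sums (B / 2 ^ T * (1 / (1 - 1 / 2)))"
    by (intro sums_mult geometric_sums) auto
  then have g: "(\<lambda>n. B / 2 ^ T * (1 / 2) ^ n) sums (2 * B / 2 ^ T)" by (simp add: mult_ac)
  have "norm (exp_mono_coeff i y (n + T) * x ^ (n + T)) \<le> B / 2 ^ T * (1 / 2) ^ n" for n
  proof -
    have "norm (exp_mono_coeff i y (n + T) * x ^ (n + T)) = \<bar>exp_mono_coeff i y (n + T)\<bar> * \<bar>x\<bar> ^ (n + T)"
      by (simp add: abs_mult power_abs)
    also have "\<dots> \<le> \<bar>exp_mono_coeff i y (n + T)\<bar> * R ^ (n + T)"
      using x by (intro mult_left_mono power_mono) auto
    also have "\<dots> \<le> B / 2 ^ (n + T)" unfolding B_def by (rule exp_mono_coeff_bound[OF R])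
    finally show ?thesis by (simp add: power_add field_simps)
  qed
  from norm_sums_le[OF s g this] show ?thesis by (simp add: B_def)
qed

section \<open>Algebraic solutions are rational\<close>

text \<open>All losses (degrees, lengths, denominators, growth of the functions) are bounded powers of
  \<open>Z = E^(E^6)\<close>, while truncating the Taylor series after \<open>T = E^7\<close> terms gains \<open>2^T = (2^E)^(E^6)\<close>.\<close>

lemma exp_eq_self_algebraic_aux:
  fixes y w :: real and k p q C E :: nat
  assumes k: "k \<ge> 1" and pq: "p \<ge> 1" "q \<ge> 1" and w1: "exp (k * w) = p / q"
    and y: "y > 0" "exp (y * w) = y" "y \<notin> \<rat>"
    and C: "C \<ge> 1" and Liouville: "\<And>P n. degree P \<le> n \<Longrightarrow> ipoly P y \<noteq> 0 \<Longrightarrow>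
      1 \<le> \<bar>ipoly P y\<bar> * (real C ^ Suc n * plen P) ^ C"
    and E: "E \<ge> 2" "E \<ge> C" "E \<ge> k + 1" "E \<ge> p * q" "real E \<ge> k + y"
      "real E \<ge> exp (2 * \<bar>w\<bar> * (k + y))" "E ^ (13 + 12 * C) < 2 ^ E"
  shows False
proof -
  \<comment> \<open>There are \<open>D1 * D2 = S * S = E ^ 8\<close> unknown coefficients and
    equally many evaluation points, but only \<open>T = E ^ 7\<close> Taylor coefficients to make
    small. The relation \<open>S * D2 = D1\<close> bounds the exponents that arise at the
    points.\<close>
  define S where "S = E ^ 4"
  define D1 where "D1 = E ^ 6"
  define D2 where "D2 = E ^ 2"
  define T where "T = E ^ 7"
  \<comment> \<open>Chosen so that \<open>X ^ card I = (2 ^ (2 * T)) ^ T\<close>, the bound for the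
    number of pigeonholes.\<close>
  define X :: nat where "X = 2 ^ (2 * D1)"
  define I where "I = {..<D1} \<times> {..<D2}"
  define Z where "Z = real E ^ D1"
  define R where "R = (k + y) * S"
  have SD: "S * D2 = D1" "D2 * D1 = S * S" "T = E * D1"
    by (simp_all add: S_def D1_def D2_def T_def flip: power_add power_Suc)
  have cardI: "card I = E ^ 8" by (simp add: I_def D1_def D2_def flip: power_add)
  have finI: "finite I" by (simp add: I_def)
  have Er: "real E \<ge> 2" using E(1) by simp
  have "(2::nat) ^ 6 \<le> D1" unfolding D1_def using E(1) by (intro power_mono) auto
  then have D1: "D1 \<ge> 8" by simp
  have EZ: "real E ^ n \<le> Z" if "n \<le> D1" for n
    unfolding Z_def using Er that by (intro power_increasing) auto
  have Z2: "Z \<ge> 2" using EZ[of 1] D1 Er by simp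
  have Zmono: "Z ^ a \<le> Z ^ b" if "a \<le> b" for a b
    using Z2 that by (intro power_increasing) auto
  have EnZ: "(real E ^ n) ^ D1 = Z ^ n" for n
    by (simp add: Z_def mult.commute flip: power_mult)
  have leZ: "a ^ D1 \<le> Z ^ n" if "0 \<le> a" "a \<le> real E ^ n" for a n
    unfolding EnZ[symmetric] using that by (intro power_mono) auto
  \<comment> \<open>The assumption \<open>E ^ (13 + 12 * C) < 2 ^ E\<close> is raised to the power
    \<open>D1\<close>, as \<open>T = E * D1\<close>.\<close>
  have big: "Z ^ (13 + 12 * C) < 2 ^ T"
  proof -
    have "real (E ^ (13 + 12 * C)) < real (2 ^ E)" using E(7) by (simp only: of_nat_less_iff)
    then have "(real E ^ (13 + 12 * C)) ^ D1 < (2 ^ E) ^ D1"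
      using D1 by (intro power_strict_mono) auto
    then show ?thesis unfolding EnZ by (simp add: SD flip: power_mult)
  qed
  have XZ: "real X \<le> Z ^ 2"
  proof -
    have "real X = (2 ^ 2) ^ D1" by (simp add: X_def power_mult)
    also have "\<dots> \<le> Z ^ 2" using Er by (intro leZ power_mono) auto
    finally show ?thesis .
  qed
  have LZ: "real (card I) \<le> Z" using EZ[of 8] D1 by (simp add: cardI)
  have TZ: "real T \<le> Z" using EZ[of 7] D1 by (simp add: T_def)
  have kh: "1 \<le> k + y" using k y by (simp add: add_increasing2)
  have S1: "1 \<le> real S" unfolding S_def using E(1) by simp
  have R1: "R \<ge> 1" unfolding R_def using mult_mono[OF kh S1] kh by simp
  have R2: "2 * R \<le> real E ^ 6"
  proof -
    have "2 * R = 2 * (k + y) * real E ^ 4" by (simp add: R_def S_def)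
    also have "\<dots> \<le> real E * real E * real E ^ 4"
      using Er E(5) kh by (intro mult_mono) auto
    finally show ?thesis by (simp add: eval_nat_numeral)
  qed
  have B: "(2 * R) ^ i * exp (2 * \<bar>j * w\<bar> * R) \<le> Z ^ 7" if "i < D1" "j < D2" for i j
  proof -
    have "(2 * R) ^ i \<le> (2 * R) ^ D1" using R1 that by (intro power_increasing) auto
    also have "\<dots> \<le> Z ^ 6" using R1 R2 by (intro leZ) auto
    finally have 1: "(2 * R) ^ i \<le> Z ^ 6" .
    have "2 * \<bar>j * w\<bar> * R \<le> 2 * (D2 * \<bar>w\<bar>) * R"
      using that R1 by (intro mult_right_mono mult_left_mono) (auto simp: abs_mult intro!: mult_right_mono)
    also have "\<dots> = real (S * D2) * (2 * \<bar>w\<bar> * (k + y))" by (simp add: R_def)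
    finally have "exp (2 * \<bar>j * w\<bar> * R) \<le> exp (2 * \<bar>w\<bar> * (k + y)) ^ D1"
      by (simp add: SD flip: exp_of_nat_mult)
    also have "\<dots> \<le> Z ^ 1" using E(6) by (intro leZ) auto
    finally have "exp (2 * \<bar>j * w\<bar> * R) \<le> Z" by simp
    from mult_mono[OF 1 this] Z2 show ?thesis by (simp add: eval_nat_numeral)
  qed
  \<comment> \<open>Scaling by \<open>R ^ t\<close> lets small combinations of the \<open>u\<close>
    control the truncated series on the whole interval from \<open>-R\<close> to
    \<open>R\<close>.\<close>
  define u where "u = (\<lambda>(i, j) t. exp_mono_coeff i (real j * w) t * R ^ t)"
  have uB: "\<bar>u ij t\<bar> \<le> Z ^ 7" if ijI: "ij \<in> I" for ij t
  proof -
    obtain i j where ij: "ij = (i, j)" "i < D1" "j < D2" using ijI by (cases ij) (auto simp: I_def)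
    have "\<bar>u ij t\<bar> = \<bar>exp_mono_coeff i (j * w) t\<bar> * R ^ t"
      using R1 by (simp add: ij u_def abs_mult)
    also have "\<dots> \<le> (2 * R) ^ i * exp (2 * \<bar>j * w\<bar> * R) / 2 ^ t"
      by (rule exp_mono_coeff_bound[OF R1])
    also have "\<dots> \<le> (2 * R) ^ i * exp (2 * \<bar>j * w\<bar> * R) / 1"
      using R1 by (intro divide_left_mono) auto
    also have "\<dots> \<le> Z ^ 7" using B ij by simp
    finally show ?thesis .
  qed
  have T2: "T \<ge> 2"
  proof -
    have "(2::nat) * 8 \<le> E * D1" using E(1) D1 by (intro mult_mono) auto
    then show ?thesis using SD by simp
  qed
  then obtain r where r: "T = Suc r" by (cases T) auto
  \<comment> \<open>Here \<open>M = 2 ^ (2 * T - 2)\<close>: it is large enough since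
    \<open>4 * Z ^ 10 \<le> Z ^ 12 \<le> 2 ^ T\<close>, and \<open>2 * M + 1\<close> still stays
    below \<open>2 ^ (2 * T)\<close>.\<close>
  obtain c :: "nat \<times> nat \<Rightarrow> int" where c: "\<And>ij. ij \<in> I \<Longrightarrow> \<bar>c ij\<bar> \<le> int X"
    "\<exists>ij\<in>I. c ij \<noteq> 0" "\<And>t. t < T \<Longrightarrow> \<bar>\<Sum>ij\<in>I. of_int (c ij) * u ij t\<bar> \<le> 1 / 2 ^ T"
  proof (rule small_integer_combination[OF finI, of T u "Z ^ 7" "1 / 2 ^ T" X "2 ^ (2 * T - 2)"])
    show "\<bar>u i t\<bar> \<le> Z ^ 7" if "i \<in> I" "t < T" for i t using uB that by simp
    show "0 < 1 / (2::real) ^ T" by simp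
    have "real (card I) * real X * Z ^ 7 \<le> Z * Z ^ 2 * Z ^ 7"
      by (intro mult_mono) (use LZ XZ Z2 in auto)
    from mult_mono[OF power_mono[OF Z2, of 2] this]
    have "2 ^ 2 * (real (card I) * real X * Z ^ 7) \<le> Z ^ 2 * (Z * Z ^ 2 * Z ^ 7)"
      using Z2 by simp
    also have "\<dots> = Z ^ 12" by (simp add: eval_nat_numeral)
    also have "\<dots> \<le> 2 ^ T" using big Zmono[of 12 "13 + 12 * C"] by simp
    finally have "2 ^ 2 * (real (card I) * real X * Z ^ 7) * 2 ^ T \<le> 2 ^ T * 2 ^ T" by simp
    also have "\<dots> = (2::real) ^ 2 * 2 ^ (2 * T - 2)" by (simp add: r power_even_eq power2_eq_square)
    finally show "real (card I) * real X * Z ^ 7 \<le> real (2 ^ (2 * T - 2)) * (1 / 2 ^ T)"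
      by (simp add: field_simps)
    have "2 * 2 ^ (2 * T - 2) + 1 \<le> (2::nat) * 2 ^ (2 * T - 2) + 2 * 2 ^ (2 * T - 2)"
      by (intro add_left_mono) simp
    also have "\<dots> = 2 ^ 2 * 2 ^ (2 * T - 2)" by simp
    also have "\<dots> = 2 ^ (2 * T)" by (simp add: r)
    finally have "(2 * 2 ^ (2 * T - 2) + 1) ^ T \<le> ((2::nat) ^ (2 * T)) ^ T" by (rule power_mono) simp
    also have "\<dots> = X ^ card I"
      unfolding X_def cardI T_def D1_def by (simp flip: power_mult power_add add: mult.assoc)
    also have "\<dots> < (X + 1) ^ card I" using E(1) by (intro power_strict_mono) (auto simp: cardI)
    finally show "(2 * 2 ^ (2 * T - 2) + 1) ^ T < (X + 1) ^ card I" .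
  qed blast
  have cX: "\<bar>real_of_int (c ij)\<bar> \<le> real X" if "ij \<in> I" for ij
    using c(1)[OF that] by linarith
  define F where "F = (\<lambda>x. \<Sum>(i, j)\<in>I. of_int (c (i, j)) * (x ^ i * exp (real j * w * x)))"
  \<comment> \<open>The Taylor series is cut at \<open>T\<close>: the head is small by the choice of
    \<open>c\<close>, the tail by the truncation estimate.\<close>
  have F_small: "\<bar>F x\<bar> \<le> Z ^ 12 / 2 ^ T" if x: "\<bar>x\<bar> \<le> R" for x
  proof -
    define f where "f = (\<lambda>(i, j). x ^ i * exp (real j * w * x))"
    define a where "a = (\<lambda>(i, j) t. exp_mono_coeff i (real j * w) t)"
    have F: "F x = (\<Sum>ij\<in>I. of_int (c ij) * f ij)"
      unfolding F_def f_def by (intro sum.cong) auto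
    have "(\<Sum>ij\<in>I. of_int (c ij) * (\<Sum>t<T. a ij t * x ^ t)) = (\<Sum>t<T. (\<Sum>ij\<in>I. of_int (c ij) * a ij t) * x ^ t)"
      unfolding sum_distrib_left sum_distrib_right by (subst sum.swap) (simp add: mult_ac)
    then have split: "F x = (\<Sum>t<T. (\<Sum>ij\<in>I. of_int (c ij) * a ij t) * x ^ t)
        + (\<Sum>ij\<in>I. of_int (c ij) * (f ij - (\<Sum>t<T. a ij t * x ^ t)))"
      unfolding F right_diff_distrib sum_subtractf by simp
    have "\<bar>\<Sum>t<T. (\<Sum>ij\<in>I. of_int (c ij) * a ij t) * x ^ t\<bar> \<le> (\<Sum>t<T. 1 / 2 ^ T)"
    proof (rule order_trans[OF sum_abs sum_mono])
      fix t assume t: "t \<in> {..<T}"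
      have "\<bar>(\<Sum>ij\<in>I. of_int (c ij) * a ij t) * x ^ t\<bar> \<le> \<bar>\<Sum>ij\<in>I. of_int (c ij) * a ij t\<bar> * R ^ t"
        unfolding abs_mult power_abs using x by (intro mult_left_mono power_mono) auto
      also have "\<dots> = \<bar>(\<Sum>ij\<in>I. of_int (c ij) * a ij t) * R ^ t\<bar>"
        using R1 by (simp add: abs_mult)
      also have "(\<Sum>ij\<in>I. of_int (c ij) * a ij t) * R ^ t = (\<Sum>ij\<in>I. of_int (c ij) * u ij t)"
        unfolding sum_distrib_right u_def a_def by (intro sum.cong) (auto simp: mult_ac)
      also have "\<bar>\<dots>\<bar> \<le> 1 / 2 ^ T" using c(3) t by simp
      finally show "\<bar>(\<Sum>ij\<in>I. of_int (c ij) * a ij t) * x ^ t\<bar> \<le> 1 / 2 ^ T" .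
    qed
    moreover have "\<bar>\<Sum>ij\<in>I. of_int (c ij) * (f ij - (\<Sum>t<T. a ij t * x ^ t))\<bar>
        \<le> (\<Sum>ij\<in>I. real X * (2 * Z ^ 7 / 2 ^ T))"
    proof (rule order_trans[OF sum_abs sum_mono])
      fix ij assume ijI: "ij \<in> I"
      then obtain i j where ij: "ij = (i, j)" "i < D1" "j < D2" by (cases ij) (auto simp: I_def)
      have "\<bar>f ij - (\<Sum>t<T. a ij t * x ^ t)\<bar> \<le> 2 * ((2 * R) ^ i * exp (2 * \<bar>j * w\<bar> * R)) / 2 ^ T"
        unfolding f_def a_def ij(1) prod.case by (rule exp_mono_Taylor[OF R1 x])
      also have "\<dots> \<le> 2 * Z ^ 7 / 2 ^ T"
        using B[OF ij(2,3)] by (intro divide_right_mono mult_left_mono) auto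
      finally show "\<bar>of_int (c ij) * (f ij - (\<Sum>t<T. a ij t * x ^ t))\<bar> \<le> real X * (2 * Z ^ 7 / 2 ^ T)"
        unfolding abs_mult using cX[OF ijI] by (intro mult_mono) auto
    qed
    ultimately have "\<bar>F x\<bar> \<le> real T * (1 / 2 ^ T) + real (card I) * (real X * (2 * Z ^ 7 / 2 ^ T))"
      unfolding split by simp
    also have "\<dots> = (real T + real (card I) * real X * (2 * Z ^ 7)) / 2 ^ T"
      by (simp add: field_simps)
    also have "\<dots> \<le> (Z + Z * Z ^ 2 * (Z * Z ^ 7)) / 2 ^ T"
      by (intro divide_right_mono add_mono mult_mono) (use TZ LZ XZ Z2 in auto)
    also have "\<dots> \<le> (Z ^ 11 + Z ^ 11) / 2 ^ T"
    proof -
      have "Z \<le> Z ^ 11" using Zmono[of 1 11] by simp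
      then show ?thesis by (intro divide_right_mono) (auto simp: eval_nat_numeral)
    qed
    also have "\<dots> \<le> Z ^ 12 / 2 ^ T"
    proof -
      have "2 * Z ^ 11 \<le> Z * Z ^ 11" using Z2 by (intro mult_right_mono) auto
      then show ?thesis by (intro divide_right_mono) (auto simp: eval_nat_numeral)
    qed
    finally show ?thesis .
  qed
  \<comment> \<open>At these points \<open>exp (j * w * x)\<close> is a power of
    \<open>p / q\<close> times a power of \<open>y\<close>, so \<open>F\<close> is, up to a
    denominator, an integer polynomial in \<open>y\<close>. A nonzero value would be too small for
    Liouville's inequality.\<close>
  have F_zero: "F (real k * m + n * y) = 0" if mn: "m < S" "n < S" for m n
  proof (rule ccontr)
    assume F0: "F (real k * m + n * y) \<noteq> 0"
    define x where "x = real k * m + n * y"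
    have "\<bar>x\<bar> \<le> R"
    proof -
      have "x \<le> real k * S + S * y"
        unfolding x_def using mn y by (intro add_mono mult_mono) auto
      moreover have "x \<ge> 0" unfolding x_def using y by simp
      ultimately show ?thesis by (simp add: R_def algebra_simps)
    qed
    \<comment> \<open>Multiplication by \<open>q ^ D1\<close> clears every denominator because
      \<open>m * j \<le> D1\<close>.\<close>
    define P where "P = (\<Sum>(i, j)\<in>I. smult (c (i, j) * (int p ^ (m * j) * int q ^ (D1 - m * j)))
        ([:int (k * m), int n:] ^ i * monom 1 (n * j)))"
    have mj: "m * j \<le> D1" "n * j \<le> D1" if "j < D2" for j
      using mult_mono[of m S j D2] mult_mono[of n S j D2] mn that SD by auto
    have Px: "ipoly P y = real q ^ D1 * F x"
    proof -
      have "ipoly (smult (c (i, j) * (int p ^ (m * j) * int q ^ (D1 - m * j)))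
          ([:int (k * m), int n:] ^ i * monom 1 (n * j))) y
        = real q ^ D1 * (of_int (c (i, j)) * (x ^ i * exp (real j * w * x)))" if "j < D2" for i j
      proof -
        have "exp (real j * w * x) = exp (real (m * j) * (k * w) + real (n * j) * (y * w))"
          by (simp add: x_def algebra_simps)
        also have "\<dots> = (real p / q) ^ (m * j) * y ^ (n * j)"
          unfolding exp_add exp_of_nat_mult[of "m * j"] exp_of_nat_mult[of "n * j"] w1 y(2) ..
        finally have e: "exp (real j * w * x) = (real p / q) ^ (m * j) * y ^ (n * j)" .
        have qq: "real q ^ D1 = real q ^ (D1 - m * j) * real q ^ (m * j)"
          using mj[OF that] by (simp flip: power_add)
        show ?thesis
          unfolding e qq using pq by (simp add: ipoly_smult ipoly_mult ipoly_power ipoly_monom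
            ipoly_pCons x_def power_divide algebra_simps)
      qed
      then show ?thesis
        unfolding P_def F_def ipoly_sum sum_distrib_left
        by (intro sum.cong) (auto simp: I_def)
    qed
    have degP: "degree P \<le> 2 * D1"
      unfolding P_def
    proof (rule degree_sum_le[OF finI])
      fix ij assume "ij \<in> I"
      then obtain i j where ij: "ij = (i, j)" "i < D1" "j < D2" by (cases ij) (auto simp: I_def)
      have "degree ([:int (k * m), int n:] ^ i * monom 1 (n * j)) \<le> degree ([:int (k * m), int n:] ^ i) + n * j"
        using degree_mult_le degree_monom_le by (metis add_left_mono le_trans)
      also have "\<dots> \<le> 1 * i + n * j"
        using degree_power_le[of "[:int (k * m), int n:]" i] by (auto intro: order_trans)
      also have "\<dots> \<le> 2 * D1" using ij mj(2)[of j] by simp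
      finally show "degree (case ij of (i, j) \<Rightarrow> smult (c (i, j) * (int p ^ (m * j) * int q ^ (D1 - m * j)))
        ([:int (k * m), int n:] ^ i * monom 1 (n * j))) \<le> 2 * D1"
        unfolding ij prod.case using degree_smult_le le_trans by blast
    qed
    have plenP: "real_of_int (plen P) \<le> Z ^ 9"
    proof -
      have "plen P \<le> (\<Sum>ij\<in>I. int X * int ((p * q) ^ D1) * int (((k + 1) * S) ^ D1))"
        unfolding P_def
      proof (rule order_trans[OF plen_sum sum_mono])
        fix ij assume ijI: "ij \<in> I"
        then obtain i j where ij: "ij = (i, j)" "i < D1" "j < D2" by (cases ij) (auto simp: I_def)
        have "\<bar>c (i, j)\<bar> * \<bar>int p ^ (m * j) * int q ^ (D1 - m * j)\<bar> \<le> int X * int ((p * q) ^ D1)"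
        proof (intro mult_mono)
          have "p ^ (m * j) * q ^ (D1 - m * j) \<le> p ^ D1 * q ^ D1"
            using pq mj(1)[OF ij(3)] by (intro mult_mono power_increasing) auto
          then have "int (p ^ (m * j) * q ^ (D1 - m * j)) \<le> int (p ^ D1 * q ^ D1)"
            by (simp only: of_nat_le_iff)
          then show "\<bar>int p ^ (m * j) * int q ^ (D1 - m * j)\<bar> \<le> int ((p * q) ^ D1)"
            by (simp add: power_mult_distrib abs_mult power_abs)
        qed (use c(1) ijI ij in auto)
        moreover have "plen ([:int (k * m), int n:] ^ i * monom 1 (n * j)) \<le> int (((k + 1) * S) ^ D1)"
        proof -
          have "plen ([:int (k * m), int n:] ^ i * monom 1 (n * j)) \<le> plen ([:int (k * m), int n:]) ^ i * 1"
            using plen_mult[of "[:int (k * m), int n:] ^ i" "monom 1 (n * j)"]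
              plen_power[of "[:int (k * m), int n:]" i] by (simp add: plen_monom)
          also have "\<dots> = int ((k * m + n) ^ i)" by (simp add: plen_pCons)
          also have "(k * m + n) ^ i \<le> ((k + 1) * S) ^ i"
          proof (rule power_mono)
            have "k * m + n \<le> k * S + S" using mn by (intro add_mono mult_mono) auto
            then show "k * m + n \<le> (k + 1) * S" by simp
          qed simp
          also have "\<dots> \<le> ((k + 1) * S) ^ D1"
            using ij S1 by (intro power_increasing) auto
          finally show ?thesis by simp
        qed
        ultimately show "plen (case ij of (i, j) \<Rightarrow> smult (c (i, j) * (int p ^ (m * j) * int q ^ (D1 - m * j)))
          ([:int (k * m), int n:] ^ i * monom 1 (n * j))) \<le> int X * int ((p * q) ^ D1) * int (((k + 1) * S) ^ D1)"
          unfolding ij prod.case plen_smult abs_mult[symmetric]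
          by (intro mult_mono) (auto simp: plen_nonneg abs_mult)
      qed
      also have "\<dots> = int (card I * (X * (p * q) ^ D1 * ((k + 1) * S) ^ D1))" by simp
      finally have "real_of_int (plen P) \<le> real_of_int (int (card I * (X * (p * q) ^ D1 * ((k + 1) * S) ^ D1)))"
        by (simp only: of_int_le_iff)
      also have "\<dots> = real (card I) * (real X * real (p * q) ^ D1 * real ((k + 1) * S) ^ D1)" by simp
      also have "\<dots> \<le> Z * (Z ^ 2 * Z ^ 1 * Z ^ 5)"
      proof (intro mult_mono leZ)
        show "real (p * q) \<le> real E ^ 1" using E(4) by (metis of_nat_le_iff power_one_right)
        have "(k + 1) * S \<le> E * E ^ 4" unfolding S_def using E(3) by (intro mult_right_mono) auto
        then have "real ((k + 1) * S) \<le> real (E * E ^ 4)" by (simp only: of_nat_le_iff)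
        then show "real ((k + 1) * S) \<le> real E ^ 5" by (simp add: eval_nat_numeral)
      qed (use LZ XZ Z2 in auto)
      also have "\<dots> = Z ^ 9" by (simp add: eval_nat_numeral)
      finally show ?thesis .
    qed
    have "1 \<le> \<bar>ipoly P y\<bar> * (real C ^ Suc (2 * D1) * plen P) ^ C"
      using F0 pq by (intro Liouville degP) (simp add: Px flip: x_def)
    also have "\<dots> = real q ^ D1 * \<bar>F x\<bar> * (real C ^ Suc (2 * D1) * plen P) ^ C"
      by (simp add: Px abs_mult)
    \<comment> \<open>\<open>Z ^ 1\<close> bounds \<open>q ^ D1\<close>,
      \<open>Z ^ 12 / 2 ^ T\<close> is the smallness of \<open>F\<close>, \<open>Z ^ 3\<close>
      bounds the power of \<open>C\<close> and \<open>Z ^ 9\<close> the length of \<open>P\<close>.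
      This explains the exponent in \<open>big\<close>.\<close>
    also have "\<dots> \<le> Z ^ 1 * (Z ^ 12 / 2 ^ T) * (Z ^ 3 * Z ^ 9) ^ C"
    proof (intro mult_mono power_mono leZ F_small)
      have "q \<le> E" using E(4) pq by (metis le_trans mult_le_mono1 mult_1)
      then show "real q \<le> real E ^ 1" by simp
      have "real C ^ Suc (2 * D1) \<le> real C ^ (3 * D1)"
        using C D1 by (intro power_increasing) auto
      also have "\<dots> = (real C ^ 3) ^ D1" by (simp add: power_mult)
      also have "\<dots> \<le> Z ^ 3" using E(2) by (intro leZ power_mono) auto
      finally show "real C ^ Suc (2 * D1) \<le> Z ^ 3" .
    qed (use \<open>\<bar>x\<bar> \<le> R\<close> plenP Z2 in \<open>auto simp: plen_nonneg\<close>)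
    also have "\<dots> = Z ^ (13 + 12 * C) / 2 ^ T"
    proof -
      have "(Z ^ 3 * Z ^ 9) ^ C = Z ^ (12 * C)" by (simp add: power_mult flip: power_add)
      moreover have "Z ^ 1 * Z ^ 12 = Z ^ 13" by (simp flip: power_Suc)
      ultimately show ?thesis by (simp add: power_add)
    qed
    finally show False using big by (simp add: field_simps)
  qed
  define Q where "Q = (\<lambda>j. \<Sum>i<D1. monom (real_of_int (c (i, j))) i)"
  have coeffQ: "coeff (Q j) i = (if i < D1 then of_int (c (i, j)) else 0)" for i j
    by (simp add: Q_def coeff_sum)
  define W where "W = (\<lambda>(m, n). real k * real m + real n * y) ` ({..<S} \<times> {..<S})"
  have w0: "w \<noteq> 0" using y by auto
  \<comment> \<open>Irrationality of \<open>y\<close> makes the \<open>S * S\<close> points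
    distinct.\<close>
  have inj: "inj_on (\<lambda>(m, n). real k * real m + real n * y) ({..<S} \<times> {..<S})"
  proof (rule inj_onI, clarify)
    fix m n m' n' :: nat
    assume eq: "real k * m + real n * y = real k * m' + real n' * y"
    have "n = n'"
    proof (rule ccontr)
      assume "n \<noteq> n'"
      then have "y = (real k * m' - real k * m) / (real n - real n')"
        using eq by (simp add: field_simps)
      then show False using y(3) by (metis Rats_diff Rats_divide Rats_mult Rats_of_nat)
    qed
    with eq k show "m = m' \<and> n = n'" by simp
  qed
  \<comment> \<open>The \<open>S * S = D2 * D1\<close> zeros are just enough for \<open>D2\<close>
    frequencies with polynomials of degree below \<open>D1\<close>.\<close>
  have "Q j = 0" if "j < D2" for j
  proof (rule exp_poly_zeros[OF w0 _ _ _ _ that])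
    show "coeff (Q j) i = 0" if "D1 \<le> i" for i j using that by (simp add: coeffQ)
    show "finite W" by (simp add: W_def)
    show "card W = D2 * D1" unfolding W_def by (subst card_image[OF inj]) (simp add: SD)
    fix z assume "z \<in> W"
    then have "F z = 0" using F_zero by (auto simp: W_def)
    moreover have "F z = (\<Sum>j<D2. \<Sum>i<D1. of_int (c (i, j)) * (z ^ i * exp (real j * w * z)))"
      unfolding F_def I_def by (subst sum.swap) (simp add: sum.cartesian_product)
    moreover have "\<dots> = (\<Sum>j<D2. poly (Q j) z * exp (real j * w * z))"
      by (simp add: Q_def poly_sum poly_monom sum_distrib_left mult_ac)
    ultimately show "(\<Sum>j<D2. poly (Q j) z * exp (real j * w * z)) = 0" by simp
  qed
  then have "c (i, j) = 0" if "i < D1" "j < D2" for i j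
    using coeffQ[of j i] that by simp
  with c(2) show False by (auto simp: I_def)
qed

text \<open>\<open>w\<close> is the logarithm of the base, so the hypotheses say that its
  \<open>k\<close>-th power is rational and that \<open>y\<close> is a fixed point. It remains to
  find a large enough \<open>E\<close> for the contradiction: a maximum meets the explicit bounds,
  and exponential growth gives the last one.\<close>

lemma exp_eq_self_algebraic_imp_rational:
  fixes y w :: real and k p q :: nat
  assumes "k \<ge> 1" "p \<ge> 1" "q \<ge> 1" "exp (k * w) = p / q"
    and "y > 0" "exp (y * w) = y" "algebraic y"
  shows "y \<in> \<rat>"
proof (rule ccontr)
  assume "y \<notin> \<rat>"
  obtain C :: nat where C: "C \<ge> 1" "\<And>P n. degree P \<le> n \<Longrightarrow> ipoly P y \<noteq> 0 \<Longrightarrow>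
      1 \<le> \<bar>ipoly P y\<bar> * (real C ^ Suc n * plen P) ^ C"
    using Liouville_inequality[OF assms(7)] by blast
  define m where "m = 13 + 12 * C"
  have "filterlim (\<lambda>n. real n * ln 2) at_top sequentially"
    by (intro filterlim_tendsto_pos_mult_at_top[OF tendsto_const] filterlim_real_sequentially
          filterlim_at_top_mult_tendsto_pos[OF tendsto_const]) auto
  then have "(\<lambda>n. (real n * ln 2) ^ m / exp (real n * ln 2)) \<longlonglongrightarrow> 0"
    by (rule filterlim_compose[OF tendsto_power_div_exp_0])
  \<comment> \<open>After cancelling \<open>ln 2 ^ m\<close> this says \<open>n ^ m < 2 ^ n\<close>
    for all large \<open>n\<close>.\<close>
  then have "eventually (\<lambda>n. (real n * ln 2) ^ m / exp (real n * ln 2) < ln 2 ^ m) sequentially"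
    by (rule order_tendstoD(2)) simp
  then obtain N where N: "\<And>n. n \<ge> N \<Longrightarrow> (real n * ln 2) ^ m / exp (real n * ln 2) < ln 2 ^ m"
    by (auto simp: eventually_sequentially)
  define E where "E = Max {N, 2, C, k + 1, p * q, nat \<lceil>k + y\<rceil>, nat \<lceil>exp (2 * \<bar>w\<bar> * (k + y))\<rceil>}"
  have E: "E \<ge> N" "E \<ge> 2" "E \<ge> C" "E \<ge> k + 1" "E \<ge> p * q" "nat \<lceil>k + y\<rceil> \<le> E"
    "nat \<lceil>exp (2 * \<bar>w\<bar> * (k + y))\<rceil> \<le> E"
    unfolding E_def by (intro Max_ge; simp)+
  have "exp (real E * ln 2) = 2 ^ E" by (simp add: exp_of_nat_mult)
  with N[OF E(1)] have "real E ^ m < 2 ^ E"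
    by (simp add: power_mult_distrib field_simps)
  then have "real (E ^ m) < real (2 ^ E)" by simp
  then have "E ^ m < 2 ^ E" by (simp only: of_nat_less_iff)
  moreover have "real E \<ge> k + y" "real E \<ge> exp (2 * \<bar>w\<bar> * (k + y))"
    using E(6,7) by linarith+
  ultimately show False
    using exp_eq_self_algebraic_aux[OF assms(1-6) \<open>y \<notin> \<rat>\<close> C E(2-5)] by (simp add: m_def)
qed

section \<open>Convergence of power towers\<close>

lemma LIMSEQ_even_odd:
  fixes X :: "nat \<Rightarrow> 'a :: topological_space"
  assumes "(\<lambda>n. X (2 * n)) \<longlonglongrightarrow> L" "(\<lambda>n. X (Suc (2 * n))) \<longlonglongrightarrow> L"
  shows "X \<longlonglongrightarrow> L"
proof (rule topological_tendstoI)
  fix S assume S: "open S" "L \<in> S"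
  from topological_tendstoD[OF assms(1) S] topological_tendstoD[OF assms(2) S]
  obtain N M where N: "\<And>n. n \<ge> N \<Longrightarrow> X (2 * n) \<in> S" and M: "\<And>n. n \<ge> M \<Longrightarrow> X (Suc (2 * n)) \<in> S"
    by (auto simp: eventually_sequentially)
  have "X n \<in> S" if "n \<ge> Suc (2 * (N + M))" for n
  proof (cases "even n")
    case True
    then obtain j where "n = 2 * j" by (elim evenE)
    then show ?thesis using N[of j] that by simp
  next
    case False
    then obtain j where "n = Suc (2 * j)" by (metis oddE Suc_eq_plus1)
    then show ?thesis using M[of j] that by simp
  qed
  then show "eventually (\<lambda>n. X n \<in> S) sequentially"
    by (auto simp: eventually_sequentially)
qed

section \<open>The function \<open>ln y / y\<close> and iteration of exponentials\<close>

text \<open>The derivative \<open>(1 - ln x) / x\<^sup>2\<close> is positive below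
  \<open>exp 1\<close>.\<close>

lemma ln_over_self_inj:
  fixes a b :: real
  assumes "0 < a" "a \<le> b" "b \<le> exp 1" "ln a / a = ln b / b"
  shows "a = b"
proof (rule ccontr)
  assume "a \<noteq> b"
  then have "a < b" using assms by simp
  then have "ln a / a < ln b / b"
  proof (rule DERIV_pos_imp_increasing_open)
    fix x assume x: "a < x" "x < b"
    then have x0: "0 < x" using assms by simp
    have "ln x < 1" using x x0 assms(3) by (metis exp_gt_zero less_le_trans ln_exp ln_less_cancel_iff)
    then have "(1 - ln x) / x\<^sup>2 > 0" using x0 by simp
    moreover have "((\<lambda>x. ln x / x) has_real_derivative (1 - ln x) / x\<^sup>2) (at x)"
      using x0 by (auto intro!: derivative_eq_intros simp: field_simps power2_eq_square)
    ultimately show "\<exists>y. ((\<lambda>x. ln x / x) has_real_derivative y) (at x) \<and> y > 0" by blast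
  next
    show "continuous_on {a..b} (\<lambda>x. ln x / x)"
      using assms by (intro continuous_intros) auto
  qed
  with assms(4) show False by simp
qed

lemma ln_over_self_bounds:
  fixes y :: real
  assumes "1 / exp 1 \<le> y"
  shows "- exp 1 \<le> ln y / y" "ln y / y \<le> 1 / exp 1"
proof -
  have y: "0 < y" using assms by (rule less_le_trans[rotated]) simp
  have "ln (1 / exp 1) \<le> ln y" using assms y by (subst ln_le_cancel_iff) auto
  then have "- 1 \<le> ln y" by (simp add: ln_div)
  then have "- ln y \<le> 1" by simp
  also have "1 \<le> exp 1 * y" using assms by (simp add: field_simps)
  finally show "- exp 1 \<le> ln y / y" using y by (simp add: field_simps)
  have "ln (y / exp 1) \<le> y / exp 1 - 1" using y by (intro ln_le_minus_one) simp
  then have "ln y \<le> y / exp 1" using y by (simp add: ln_div)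
  then show "ln y / y \<le> 1 / exp 1" using y by (simp add: field_simps)
qed

text \<open>The left side of \<open>eq\<close> is the slope at \<open>t\<close> of the double
  iterate of \<open>exp (c * t)\<close>. In terms of \<open>u = - c * exp (c * t)\<close> it is
  \<open>- c * u * exp (- u)\<close>, at most \<open>u * exp (1 - u)\<close>, which reaches its
  maximum 1 only at \<open>u = 1\<close>.\<close>

lemma exp_exp_deriv_eq_1:
  fixes c t :: real
  assumes c: "- exp 1 \<le> c" "c < 0" and eq: "exp (c * exp (c * t)) * (c * (exp (c * t) * c)) = 1"
  shows "exp (c * t) = 1 / (- c)"
proof -
  define u where "u = - c * exp (c * t)"
  have u: "u > 0" using c by (simp add: u_def mult_neg_pos)
  have "1 = u * exp (- u) * (- c)" using eq by (simp add: u_def mult_ac)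
  also have "\<dots> \<le> u * exp (- u) * exp 1" using u c by (intro mult_left_mono) auto
  also have "\<dots> = u / exp (u - 1)" by (simp add: exp_diff exp_minus field_simps)
  finally have "exp (u - 1) \<le> u" by (simp add: field_simps)
  then have "u - 1 \<le> ln u" using u by (metis exp_gt_zero ln_exp ln_le_cancel_iff)
  moreover have "ln u \<le> u - 1" using u by (rule ln_le_minus_one)
  ultimately have "u = 1" using u by (intro ln_eq_minus_one) auto
  then show ?thesis using c by (simp add: u_def field_simps)
qed

text \<open>The tower iterates \<open>f t = exp (c * t)\<close>, which fixes \<open>y\<close>. For
  \<open>c \<ge> 0\<close> it increases to a fixed point in the range where \<open>ln t / t\<close>
  is injective. For \<open>c < 0\<close> the even-indexed terms increase to a fixed point of the
  double iterate, which must be \<open>y\<close>.\<close>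

lemma tower_tendsto:
  fixes y :: real
  assumes y: "1 / exp 1 \<le> y" "y \<le> exp 1"
  shows "tower (y powr (1 / y)) \<longlonglongrightarrow> y"
proof -
  have y0: "0 < y" using y(1) by (rule less_le_trans[rotated]) simp
  define x where "x = y powr (1 / y)"
  define c where "c = ln y / y"
  define f where "f = (\<lambda>t. exp (c * t))"
  have lnx: "ln x = c" using y0 by (simp add: x_def c_def ln_powr)
  have x0: "0 < x" using y0 by (simp add: x_def)
  have t0: "tower x 0 = f 1" using x0 by (simp add: f_def flip: lnx)
  have tS: "tower x (Suc n) = f (tower x n)" for n
    using x0 lnx by (simp add: f_def powr_def mult.commute)
  have fy: "f y = y" using y0 by (simp add: f_def c_def)
  have f0: "f t > 0" for t by (simp add: f_def)
  have tpos: "tower x n > 0" for n by (cases n) (use t0 tS f0 in auto)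
  have cont: "(\<lambda>n. f (X n)) \<longlonglongrightarrow> f L" if "X \<longlonglongrightarrow> L" for X L
    unfolding f_def by (intro tendsto_intros that)
  have "tower x \<longlonglongrightarrow> y"
  proof (cases "c \<ge> 0")
    case True
    have mono: "f s \<le> f t" if "s \<le> t" for s t
      using True that by (simp add: f_def mult_left_mono)
    have y1: "1 \<le> y" using True y0 by (auto simp: c_def zero_le_divide_iff ln_ge_zero_iff)
    have le: "tower x n \<le> y" for n
    proof (induction n)
      case 0
      show ?case using mono[OF y1] fy t0 by simp
    next
      case (Suc n)
      then show ?case using mono[OF Suc] fy tS by simp
    qed
    have "tower x n \<le> tower x (Suc n)" for n
    proof (induction n)
      case 0
      have "1 \<le> f 1" using True by (simp add: f_def)
      then show ?case unfolding tS t0 by (rule mono)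
    next
      case (Suc n)
      then show ?case using mono tS by metis
    qed
    then have "incseq (tower x)" by (rule incseq_SucI)
    then obtain L where L: "tower x \<longlonglongrightarrow> L" "\<And>n. tower x n \<le> L"
      using incseq_convergent[of "tower x" y] le by auto
    have "L > 0" using tpos[of 0] L(2)[of 0] by linarith
    have "L \<le> y" using L(1) le by (intro LIMSEQ_le_const2) auto
    have "(\<lambda>n. tower x (Suc n)) \<longlonglongrightarrow> f L" unfolding tS by (rule cont[OF L(1)])
    then have "f L = L" using LIMSEQ_unique LIMSEQ_Suc[OF L(1)] by blast
    then have "ln L = c * L" by (metis f_def ln_exp)
    then have "ln L / L = ln y / y" using \<open>L > 0\<close> by (simp add: c_def)
    then have "L = y" using ln_over_self_inj \<open>L > 0\<close> \<open>L \<le> y\<close> y by blast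
    with L show ?thesis by simp
  next
    case False
    then have c0: "c < 0" by simp
    have anti: "f t \<le> f s" if "s \<le> t" for s t
      using c0 that by (simp add: f_def mult_left_mono_neg)
    have y1: "y \<le> 1" using c0 y0 by (auto simp: c_def divide_less_0_iff ln_less_zero_iff)
    have p_Suc: "tower x (2 * Suc n) = f (f (tower x (2 * n)))" for n
      by (simp only: mult_Suc_right add_2_eq_Suc tS)
    have le: "tower x (2 * n) \<le> y" for n
    proof (induction n)
      case 0
      show ?case using anti[OF y1] fy t0 by simp
    next
      case (Suc n)
      then show ?case using anti[OF anti[OF Suc]] fy unfolding p_Suc by simp
    qed
    have "tower x (2 * n) \<le> tower x (2 * Suc n)" for n
    proof (induction n)
      case 0
      have "f (f 1) \<le> 1" using c0 f0[of 1] by (simp add: f_def mult_nonpos_nonneg)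
      then show ?case using anti t0 unfolding p_Suc by simp
    next
      case (Suc n)
      then show ?case using anti[OF anti[OF Suc]] unfolding p_Suc by simp
    qed
    then have "incseq (\<lambda>n. tower x (2 * n))" by (rule incseq_SucI)
    then obtain a where a: "(\<lambda>n. tower x (2 * n)) \<longlonglongrightarrow> a"
      using incseq_convergent[of "\<lambda>n. tower x (2 * n)" y] le by metis
    have ay: "a \<le> y" using a le by (intro LIMSEQ_le_const2) auto
    have "(\<lambda>n. tower x (2 * Suc n)) \<longlonglongrightarrow> f (f a)"
      unfolding p_Suc by (intro cont a)
    then have ffa: "f (f a) = a" using LIMSEQ_unique LIMSEQ_Suc[OF a] by blast
    define g' where "g' = (\<lambda>t. exp (c * exp (c * t)) * (c * (exp (c * t) * c)))"
    have g': "((\<lambda>t. f (f t)) has_real_derivative g' t) (at t)" for t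
      unfolding f_def g'_def by (auto intro!: derivative_eq_intros)
    \<comment> \<open>By the mean value theorem the double iterate has slope 1 somewhere between two
      of its fixed points, which pins down the value of \<open>f\<close> there.\<close>
    have fixed_points: "\<exists>t. r < t \<and> t < s \<and> f t = 1 / (- c)"
      if rs: "r < s" "f (f r) = r" "f (f s) = s" for r s
    proof -
      obtain z where z: "r < z" "z < s" "f (f s) - f (f r) = (s - r) * g' z"
        using MVT2[OF rs(1), of "\<lambda>t. f (f t)" g'] g' by blast
      then have "g' z = 1" using rs by simp
      then have "f z = 1 / (- c)"
        using exp_exp_deriv_eq_1[OF _ c0, of z] ln_over_self_bounds(1)[OF y(1)]
        unfolding g'_def f_def c_def by blast
      with z show ?thesis by blast
    qed
    \<comment> \<open>Otherwise \<open>a\<close>, \<open>y\<close> and \<open>f a\<close> are three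
      increasing fixed points of the double iterate, so slope 1 occurs on both sides of
      \<open>y\<close> with the same value of the injective \<open>f\<close>.\<close>
    have "a = y"
    proof (rule ccontr)
      assume "a \<noteq> y"
      with ay have lt: "a < y" by simp
      then have "y < f a" using c0 fy by (metis f_def exp_less_mono mult_less_cancel_left_neg)
      then obtain s t where st: "s < y" "y < t" "f s = 1 / (- c)" "f t = 1 / (- c)"
        using fixed_points[of a y] fixed_points[of y "f a"] lt ffa fy by auto
      then have "exp (c * s) = exp (c * t)" by (simp add: f_def)
      with c0 st show False by simp
    qed
    with a have even: "(\<lambda>n. tower x (2 * n)) \<longlonglongrightarrow> y" by simp
    have "(\<lambda>n. tower x (Suc (2 * n))) \<longlonglongrightarrow> y"
      using cont[OF even] unfolding tS fy .
    with even show ?thesis by (rule LIMSEQ_even_odd)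
  qed
  then show ?thesis by (simp add: x_def)
qed

section \<open>The correspondence between \<open>y powr (1 / y)\<close> and \<open>h\<close>\<close>

lemma h_powr_inverse:
  assumes "1 / exp 1 \<le> y" "y \<le> exp 1"
  shows "h (y powr (1 / y)) = y"
  unfolding h_def using tower_tendsto[OF assms] by (rule limI)

lemma powr_inverse_range:
  fixes y :: real
  assumes "1 / exp 1 \<le> y"
  shows "exp (- exp 1) \<le> y powr (1 / y)" "y powr (1 / y) \<le> exp (1 / exp 1)"
proof -
  have "0 < y" using assms by (rule less_le_trans[rotated]) simp
  then have "y powr (1 / y) = exp (ln y / y)" by (simp add: powr_def)
  with ln_over_self_bounds[OF assms]
  show "exp (- exp 1) \<le> y powr (1 / y)" "y powr (1 / y) \<le> exp (1 / exp 1)" by simp_all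
qed

text \<open>The intermediate value theorem for \<open>ln y / y\<close>, which is
  \<open>- exp 1\<close> at \<open>1 / exp 1\<close> and \<open>1 / exp 1\<close> at
  \<open>exp 1\<close>.\<close>

lemma powr_inverse_surj:
  fixes A :: real
  assumes "exp (- exp 1) \<le> A" "A \<le> exp (1 / exp 1)"
  obtains y where "1 / exp 1 \<le> y" "y \<le> exp 1" "A = y powr (1 / y)"
proof -
  have A: "0 < A" using assms(1) by (rule less_le_trans[rotated]) simp
  have "\<exists>y. 1 / exp 1 \<le> y \<and> y \<le> exp 1 \<and> ln y / y = ln A"
  proof (rule IVT')
    show "ln (1 / exp 1) / (1 / exp 1) \<le> ln A"
      using A assms(1) by (simp add: ln_div ln_ge_iff)
    have "ln A \<le> ln (exp (1 / exp 1))" using A assms(2) by (subst ln_le_cancel_iff) auto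
    then show "ln A \<le> ln (exp 1) / exp 1" by simp
    show "1 / exp 1 \<le> (exp 1 :: real)" by (simp add: field_simps flip: exp_add)
    have "x \<noteq> 0" if "x \<in> {1 / exp 1..exp 1}" for x :: real
      using that by (auto simp: field_simps)
    then show "continuous_on {1 / exp 1..exp 1} (\<lambda>x::real. ln x / x)"
      by (intro continuous_intros) auto
  qed
  then obtain y where y: "1 / exp 1 \<le> y" "y \<le> exp 1" "ln y / y = ln A" by blast
  have "0 < y" using y(1) by (rule less_le_trans[rotated]) simp
  then have "y powr (1 / y) = exp (ln A)" using y(3) by (simp add: powr_def)
  with that y A show ?thesis by simp
qed

section \<open>The order of rational powers\<close>

lemma powr_quotient_power_eq:
  fixes u v :: nat
  assumes "u \<ge> 1" "v \<ge> 1"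
  shows "((real u / real v) powr (real v / real u)) ^ u = (real u / real v) ^ v"
  using assms by (simp add: powr_power powr_realpow)

text \<open>Writing the rational power as \<open>a / b\<close> in lowest terms and raising it to the
  power \<open>u\<close> gives \<open>a ^ u * v ^ (v * n) = u ^ (v * n) * b ^ u\<close>. Coprimality
  forces \<open>u ^ (v * n) = a ^ u\<close>; comparing exponents of \<open>p\<close> and cancelling
  \<open>v\<close> gives the divisibility.\<close>

lemma rational_power_powr_quotient:
  fixes u v n :: nat
  assumes uv: "u \<ge> 1" "v \<ge> 1" "coprime u v"
    and rat: "((real u / real v) powr (real v / real u)) ^ n \<in> \<rat>" and p: "prime p"
  shows "u dvd n * multiplicity p u"
proof -
  define A where "A = (real u / real v) powr (real v / real u)"
  have A: "A > 0" using uv by (simp add: A_def)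
  obtain a b :: nat where ab: "b \<noteq> 0" "\<bar>A ^ n\<bar> = real a / real b" "coprime a b"
    using Rats_abs_nat_div_natE rat unfolding A_def by metis
  have An: "A ^ n = real a / real b" using ab A by simp
  have "(real a / real b) ^ u = (A ^ u) ^ n" unfolding An[symmetric] by (simp add: mult.commute flip: power_mult)
  also have "\<dots> = (real u / real v) ^ (v * n)"
    using powr_quotient_power_eq uv by (simp add: A_def power_mult)
  finally have "real a ^ u * real v ^ (v * n) = real u ^ (v * n) * real b ^ u"
    using ab uv by (simp add: power_divide field_simps)
  then have "real (a ^ u * v ^ (v * n)) = real (u ^ (v * n) * b ^ u)" by simp
  then have eq: "a ^ u * v ^ (v * n) = u ^ (v * n) * b ^ u" by (simp only: of_nat_eq_iff)
  have "u ^ (v * n) dvd a ^ u"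
  proof -
    have "u ^ (v * n) dvd a ^ u * v ^ (v * n)" unfolding eq by simp
    moreover have "coprime (u ^ (v * n)) (v ^ (v * n))" using uv by simp
    ultimately show ?thesis using coprime_dvd_mult_left_iff by blast
  qed
  moreover have "a ^ u dvd u ^ (v * n)"
  proof -
    have "a ^ u dvd u ^ (v * n) * b ^ u" unfolding eq[symmetric] by simp
    moreover have "coprime (a ^ u) (b ^ u)" using ab by simp
    ultimately show ?thesis using coprime_dvd_mult_left_iff by blast
  qed
  ultimately have eq2: "u ^ (v * n) = a ^ u" by (rule dvd_antisym)
  then have "a \<noteq> 0" using uv by (metis One_nat_def Suc_le_D nat.distinct(1) power_not_zero zero_power zero_less_Suc)
  then have "v * n * multiplicity p u = u * multiplicity p a"
    using arg_cong[OF eq2, of "multiplicity p"] p uv by (simp add: prime_elem_multiplicity_power_distrib)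
  then have "u dvd v * (n * multiplicity p u)" by (simp add: mult.assoc)
  then show ?thesis using uv coprime_dvd_mult_right_iff by blast
qed

text \<open>If \<open>u = k m\<close> with \<open>m > 1\<close>, then \<open>m\<close> divides every exponent of \<open>u\<close>; squarefreeness of \<open>k\<close>
  leaves only \<open>m = 2\<close>, \<open>u = 4\<close>, \<open>k = 2\<close>, which is why \<open>k \<ge> 3\<close> is needed.\<close>

lemma squarefree_order_eq_numerator:
  fixes u v k :: nat
  assumes uv: "u \<ge> 1" "v \<ge> 1" "coprime u v" and k: "k \<ge> 3" "squarefree k"
    and rat: "((real u / real v) powr (real v / real u)) ^ k \<in> \<rat>"
    and least: "\<And>n. n \<ge> 1 \<Longrightarrow> ((real u / real v) powr (real v / real u)) ^ n \<in> \<rat> \<Longrightarrow> k \<le> n"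
  shows "u = k"
proof -
  define A where "A = (real u / real v) powr (real v / real u)"
  have A: "A > 0" using uv by (simp add: A_def)
  have "A ^ u \<in> \<rat>" using powr_quotient_power_eq uv by (simp add: A_def)
  moreover have "A ^ u = (A ^ k) ^ (u div k) * A ^ (u mod k)"
    by (simp flip: power_mult power_add)
  moreover have "(A ^ k) ^ (u div k) \<in> \<rat>" using rat unfolding A_def by (rule Rats_power)
  \<comment> \<open>Dividing out powers of \<open>A ^ k\<close> leaves the exponent
    \<open>u mod k\<close>, which is below the least positive one and hence zero.\<close>
  ultimately have "(A ^ k) ^ (u div k) * A ^ (u mod k) / (A ^ k) ^ (u div k) \<in> \<rat>"
    by (metis Rats_divide)
  then have "A ^ (u mod k) \<in> \<rat>" using A by simp
  then have "u mod k = 0" using least[of "u mod k"] k(1)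
    by (metis A_def One_nat_def Suc_leI gr0I linorder_not_le mod_less_divisor not_numeral_le_zero)
  then obtain m where m: "u = k * m" by auto
  have k0: "k \<noteq> 0" and m0: "m \<noteq> 0" using uv m by auto
  have dvd: "m dvd multiplicity p u" if "prime p" for p
    using rational_power_powr_quotient[OF uv rat that] k0 unfolding m by simp
  have mult_u: "multiplicity p u = multiplicity p k + multiplicity p m" if "prime p" for p
    unfolding m using k0 m0 that by (simp add: prime_elem_multiplicity_mult_distrib)
  have sqf: "multiplicity p k \<le> 1" if "prime p" for p
    using k(2) k0 that squarefree_factorial_semiring'' by blast
  have "m = 1"
  proof (rule ccontr)
    assume "m \<noteq> 1"
    then obtain p where p: "prime p" "p dvd m" using prime_factor_nat by blast
    define j where "j = multiplicity p m"
    have j1: "j \<ge> 1" unfolding j_def using p m0 by (simp add: Suc_le_eq prime_multiplicity_gt_zero_iff)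
    have "multiplicity p u \<noteq> 0" using mult_u[OF p(1)] j1 by (simp add: j_def)
    then have "m \<le> multiplicity p u" using dvd[OF p(1)] by (intro dvd_imp_le) auto
    \<comment> \<open>Together with \<open>2 ^ j \<le> p ^ j \<le> m\<close> this leaves only
      \<open>j = 1\<close>, and then \<open>m = 2\<close>.\<close>
    then have m_le: "m \<le> 1 + j" using mult_u[OF p(1)] sqf[OF p(1)] by (simp add: j_def)
    have "p ^ j \<le> m" unfolding j_def using m0 by (intro dvd_imp_le multiplicity_dvd) auto
    moreover have "2 ^ j \<le> p ^ j" using prime_ge_2_nat[OF p(1)] by (intro power_mono) auto
    ultimately have j2: "2 ^ j \<le> 1 + j" using m_le by linarith
    have "j = 1"
    proof (rule ccontr)
      assume "j \<noteq> 1"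
      with j1 have "2 \<le> j" by simp
      then obtain i where i: "j = 2 + i" using le_Suc_ex by blast
      have "i < 2 ^ i" by (rule less_exp)
      with j2 show False by (simp add: i power_add)
    qed
    have "m = 2"
      using m_le \<open>j = 1\<close> m0 \<open>m \<noteq> 1\<close> by linarith
    \<comment> \<open>A squarefree \<open>k\<close> above 2 is not a power of 2. An odd prime factor
      has exponent 1 in \<open>u = 2 * k\<close>, and \<open>m = 2\<close> does not divide
      1.\<close>
    have "\<exists>r. prime r \<and> r dvd k \<and> r \<noteq> 2"
    proof (cases "2 dvd k")
      case True
      then obtain k' where k': "k = 2 * k'" by auto
      with k(1) have "k' \<noteq> 1" by auto
      then obtain r where r: "prime r" "r dvd k'" using prime_factor_nat by blast
      have "r \<noteq> 2"
      proof
        assume "r = 2"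
        with r k' have "2\<^sup>2 dvd k" by (simp add: power2_eq_square)
        from squarefreeD[OF k(2) this] show False by simp
      qed
      with r k' show ?thesis by auto
    next
      case False
      have "k \<noteq> 1" using k by simp
      then obtain r where "prime r" "r dvd k" using prime_factor_nat by blast
      with False show ?thesis by auto
    qed
    then obtain r where r: "prime r" "r dvd k" "r \<noteq> 2" by blast
    have "\<not> r dvd m"
      using r(1,3) primes_dvd_imp_eq[OF r(1) two_is_prime_nat] by (auto simp: \<open>m = 2\<close>)
    then have "multiplicity r m = 0" by (rule not_dvd_imp_multiplicity_0)
    moreover have "multiplicity r k > 0"
      using r k0 by (simp add: prime_multiplicity_gt_zero_iff)
    then have "multiplicity r k = 1" using sqf[OF r(1)] by linarith
    ultimately show False using dvd[OF r(1)] mult_u[OF r(1)] \<open>m = 2\<close> by simp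
  qed
  with m show ?thesis by simp
qed

lemma alg_ord_eq_enat_iff:
  assumes "k \<ge> 1"
  shows "alg_ord A = enat k \<longleftrightarrow> A ^ k \<in> \<rat> \<and> (\<forall>n\<ge>1. A ^ n \<in> \<rat> \<longrightarrow> k \<le> n)"
proof
  let ?P = "\<lambda>n. n \<ge> 1 \<and> A ^ n \<in> \<rat>"
  assume L: "alg_ord A = enat k"
  then have ex: "\<exists>n. ?P n" and k: "k = (LEAST n. ?P n)"
    by (auto simp: alg_ord_def split: if_splits)
  from LeastI_ex[OF ex] Least_le[of ?P] show "A ^ k \<in> \<rat> \<and> (\<forall>n\<ge>1. A ^ n \<in> \<rat> \<longrightarrow> k \<le> n)"
    unfolding k by blast
next
  let ?P = "\<lambda>n. n \<ge> 1 \<and> A ^ n \<in> \<rat>"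
  assume R: "A ^ k \<in> \<rat> \<and> (\<forall>n\<ge>1. A ^ n \<in> \<rat> \<longrightarrow> k \<le> n)"
  with assms have "(LEAST n. ?P n) = k" by (intro Least_equality) auto
  with R assms show "alg_ord A = enat k" by (auto simp: alg_ord_def)
qed

theorem theorem2p2:
  fixes k :: nat
  assumes "k \<ge> 3" and "squarefree k"
  shows "{A :: real. algebraic A \<and> exp (- exp 1) \<le> A \<and> A \<le> exp (1 / exp 1)
                   \<and> algebraic (h A) \<and> alg_ord A = enat k}
       = {(real k / real s) powr (real s / real k) | s :: nat.
            real k / exp 1 \<le> real s \<and> real s \<le> real k * exp 1 \<and> gcd s k = 1}"
    (is "?L = ?R")
proof (intro set_eqI iffI)
  fix A assume "A \<in> ?L"
  then have A: "exp (- exp 1) \<le> A" "A \<le> exp (1 / exp 1)" "algebraic (h A)" "alg_ord A = enat k"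
    by auto
  obtain y where y: "1 / exp 1 \<le> y" "y \<le> exp 1" "A = y powr (1 / y)"
    using powr_inverse_surj[OF A(1,2)] by blast
  have y0: "y > 0" using y(1) by (rule less_le_trans[rotated]) simp
  have A0: "A > 0" using y0 y(3) by simp
  have Ak: "A ^ k \<in> \<rat>" and least: "\<And>n. n \<ge> 1 \<Longrightarrow> A ^ n \<in> \<rat> \<Longrightarrow> k \<le> n"
    using A(4) assms(1) by (auto simp: alg_ord_eq_enat_iff)
  obtain p q :: nat where pq: "q \<noteq> 0" "\<bar>A ^ k\<bar> = real p / real q"
    using Rats_abs_nat_div_natE[OF Ak] by metis
  have Apq: "A ^ k = real p / real q" using pq A0 by simp
  then have p0: "p \<noteq> 0" using A0 pq by (metis div_0 less_irrefl of_nat_0 zero_less_power)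
  \<comment> \<open>Here \<open>y = h A\<close>, so it is algebraic and satisfies
    \<open>A powr y = y\<close>; the logarithm \<open>w\<close> is \<open>ln A\<close>.\<close>
  have "y \<in> \<rat>"
  proof (rule exp_eq_self_algebraic_imp_rational)
    show "exp (real k * ln A) = real p / real q"
      using A0 Apq by (simp add: exp_of_nat_mult)
    show "exp (y * ln A) = y" using y0 by (simp add: y(3) ln_powr)
    show "algebraic y" using A(3) h_powr_inverse[OF y(1,2)] y(3) by simp
  qed (use assms pq p0 y0 in auto)
  then obtain u v :: nat where uv: "v \<noteq> 0" "\<bar>y\<bar> = real u / real v" "coprime u v"
    by (rule Rats_abs_nat_div_natE)
  have yuv: "y = real u / real v" using uv y0 by simp
  have u0: "u \<noteq> 0" using yuv y0 by (metis div_0 less_irrefl of_nat_0)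
  have Auv: "A = (real u / real v) powr (real v / real u)" by (simp add: y(3) yuv)
  have "u = k"
    by (rule squarefree_order_eq_numerator[of u v])
      (use uv u0 assms Ak least in \<open>auto simp: Auv\<close>)
  \<comment> \<open>The range of \<open>y = u / v\<close> becomes the range of the denominator,
    which plays the role of \<open>s\<close>.\<close>
  moreover have "real u / exp 1 \<le> real v" "real v \<le> real u * exp 1"
    using y(1,2) uv(1) unfolding yuv by (simp_all add: field_simps)
  ultimately show "A \<in> ?R" using Auv uv(3) by (auto simp: coprime_iff_gcd_eq_1 gcd.commute)
next
  fix A assume "A \<in> ?R"
  then obtain s :: nat where s: "real k / exp 1 \<le> real s" "real s \<le> real k * exp 1" "gcd s k = 1"
    and A: "A = (real k / real s) powr (real s / real k)" by auto
  have k1: "k \<ge> 1" using assms by simp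
  have "0 < real k / exp 1" using k1 by simp
  with s(1) have s0: "s \<ge> 1" by (metis less_le_trans of_nat_0_less_iff One_nat_def Suc_leI)
  have cop: "coprime k s" using s(3) by (simp add: coprime_iff_gcd_eq_1 gcd.commute)
  define y where "y = real k / real s"
  have y: "1 / exp 1 \<le> y" "y \<le> exp 1" "A = y powr (1 / y)"
    using s s0 k1 by (simp_all add: y_def A field_simps)
  have Ak: "A ^ k \<in> \<rat>" using powr_quotient_power_eq[OF k1 s0] by (simp add: A)
  have "algebraic A"
  proof -
    have "algebraic (root k (A ^ k))" using Ak k1 by (intro algebraic_nth_root_real rat_imp_algebraic)
    moreover have "root k (A ^ k) = A" using k1 by (intro real_root_power_cancel) (auto simp: A)
    ultimately show ?thesis by simp
  qed
  moreover have "algebraic (h A)"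
    unfolding y(3) h_powr_inverse[OF y(1,2)] by (intro rat_imp_algebraic) (simp add: y_def)
  moreover have "alg_ord A = enat k"
    unfolding alg_ord_eq_enat_iff[OF k1]
  proof (intro conjI allI impI Ak)
    fix n :: nat assume n: "1 \<le> n" "A ^ n \<in> \<rat>"
    have "k \<noteq> 1" using assms by simp
    then obtain p where p: "prime p" "p dvd k" using prime_factor_nat by blast
    \<comment> \<open>With exponent 1 at \<open>p\<close>, the divisibility
      \<open>k dvd n * multiplicity p k\<close> becomes \<open>k dvd n\<close>.\<close>
    have "multiplicity p k = 1"
      using assms k1 p squarefree_factorial_semiring'[of k] by (simp add: prime_factors_dvd)
    with rational_power_powr_quotient[OF k1 s0 cop _ p(1), of n] n have "k dvd n" by (simp add: A)
    with n show "k \<le> n" by (intro dvd_imp_le) auto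
  qed
  ultimately show "A \<in> ?L" using powr_inverse_range[OF y(1)] y(3) by simp
qed

end
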